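(* Let $\mathcal P=\langle X\mid \omega:R\to F(X)\rangle$ be a presentation of a group $G$, with canonical epimorphism $\varphi:F(X)\to G$, free crossed module $\delta_2:C(R)\to F(X)$ on $\omega$, and module of identities $\pi(\mathcal P)=\ker\delta_2$. Let $\sigma:G\to F(X)$ be a section of $\varphi$, and let $k_1:F(\widetilde X)\to C(R)$ be a groupoid morphism from the free groupoid on the Cayley graph such that $\delta_2k_1(g,x)=(\sigma g)x(\sigma(g(\varphi x)))^{-1}$ for all $g\in G$, $x\in X$. Let $C_3(I)$ be the free $G$-module on a set $I=\{[g,r]: g\in G,\ r\in R\}$ bijective with $G\times R$, and let $\delta_3:C_3(I)\to \pi(\mathcal P)\subseteq C(R)$ be the $G$-module morphism with $\delta_3[g,r]=(k_1(g,\omega r))^{-1}\,r^{(\sigma g)^{-1}}$. Let $J\subseteq I$ be a subset minimal with respect to the property that $\delta_3(J)$ generates $\pi(\mathcal P)$ as a $G$-module, and let $C_3(J)\subseteq C_3(I)$ be the free $G$-module on $J$. For each $(g,r)\in G\times R$ choose an expression of $\delta_3[g,r]$ in terms of the elements of $\delta_3(J)$, that is, an element $k_2(g,r)\in C_3(J)$ with $\delta_3(k_2(g,r))=\delta_3[g,r]$, and let $k_2:C(\widetilde R)\to C_3(J)$ be the morphism determined by these values which kills the operation of $F(\widetilde X)$. Then the elements $$\delta_4[g,\gamma]=-k_2(g,\delta_3\gamma)+\gamma\cdot g^{-1}\qquad (g\in G,\ \gamma\in J)$$ form a $G$-module generating set of the relations among the generators $\delta_3(J)$ of $\pi(\mathcal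 P)$; that is, they generate, as a $G$-module, the kernel of $\delta_3|_{C_3(J)}:C_3(J)\to\pi(\mathcal P)$.
   Context: $F(X)$ is the free group on $X$. A presentation $\langle X\mid\omega:R\to F(X)\rangle$ of $G$ consists of sets $X,R$, a function $\omega:R\to F(X)$, and an epimorphism $\varphi:F(X)\to G$ whose kernel is the normal closure of $\omega(R)$. In a groupoid, the composite of $a:x\to y$ and $b:y\to z$ is written $ab:x\to z$. A crossed module over a groupoid $\Phi$ consists of a family of groups $M=(M(x))_{x\in Ob\,\Phi}$ (a totally disconnected groupoid), a groupoid morphism $\mu:M\to\Phi$ which is the identity on objects, and a right action of $\Phi$ on $M$ (for $m\in M(x)$, $u\in\Phi(x,y)$ one has $m^u\in M(y)$, with $m^1=m$, $(m^u)^v=m^{uv}$, $(mn)^u=m^un^u$) such that $\mu(m^u)=u^{-1}\mu(m)u$ and $n^{-1}mn=m^{\mu n}$ whenever defined. When $\Phi$ is a group this is the usual notion. The free crossed $\Phi$-module on a family of functions $w:S(x)\to\Phi(x,x)$, $x\in Ob\,\Phi$, is the crossed $\Phi$-module $\mu:M\to\Phi$ with maps $S(x)\to M(x)$ lifting $w$, universal among such. $\delta_2:C(R)\to F(X)$ is the free crossed $F(X)$-module on $\omega$. The kernel $\pi(\mathcal P)$ is central in $C(R)$ and is a right $G$-module, since the action of $F(X)$ on it factors through $\varphi$. The Cayley graph $\widetilde X$ has vertex set $G$ and arrows $(g,x):g\to g(\varphi x)$ for $(g,x)\in G\times X$. The free groupoid $F(\widetilde X)$ has object set $G$ and arrows $(g,u)\in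 G\times F(X)$ with source $g$, target $g(\varphi u)$, and composition $(g,u)(g(\varphi u),v)=(g,uv)$. The group $C(R)$ is regarded as a one-object groupoid. $\widetilde\delta_2:C(\widetilde R)\to F(\widetilde X)$ is the free crossed $F(\widetilde X)$-module on $\widetilde R=G\times R$, $(g,r)\mapsto(g,\omega r)$. Explicitly $C(\widetilde R)(g)=\{g\}\times C(R)$ with $(g,c)(g,c')=(g,cc')$, $\widetilde\delta_2(g,c)=(g,\delta_2c)$ and $(g,c)^{(g,u)}=(g(\varphi u),c^u)$. A morphism $k_2$ from $C(\widetilde R)$ to an abelian group (a family of group homomorphisms, one on each $C(\widetilde R)(g)$) kills the operation of $F(\widetilde X)$ if $k_2((g,c)^{(g,u)})=k_2(g,c)$ for all $g\in G$, $c\in C(R)$, $u\in F(X)$; such a morphism is uniquely determined by arbitrary prescribed values on the elements $(g,r)\in G\times R$. $G$-modules are right modules, written additively with action $\gamma\cdot g$. *)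

theory Defs
  imports "HOL-Algebra.Free_Abelian_Groups"
begin

section \<open>Free groups\<close>

text \<open>A letter \<open>(x, True)\<close> stands for \<open>x\<close> and \<open>(x, False)\<close> for its formal inverse.
  The elements of the free group are the reduced words.\<close>

type_synonym 'a word = "('a \<times> bool) list"

definition opposite :: "'a \<times> bool \<Rightarrow> 'a \<times> bool \<Rightarrow> bool" where
  "opposite a b \<longleftrightarrow> fst a = fst b \<and> snd a \<noteq> snd b"

fun reduced :: "'a word \<Rightarrow> bool" where
  "reduced (a # b # w) \<longleftrightarrow> \<not> opposite a b \<and> reduced (b # w)"
| "reduced _ \<longleftrightarrow> True"

fun left_mult :: "'a \<times> bool \<Rightarrow> 'a word \<Rightarrow> 'a word" where
  "left_mult a [] = [a]"
| "left_mult a (b # w) = (if opposite a b then w else a # b # w)"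

definition free_group :: "'a set \<Rightarrow> 'a word monoid" where
  "free_group X = \<lparr>carrier = {w. reduced w \<and> fst ` set w \<subseteq> X}, monoid.mult = foldr left_mult, one = []\<rparr>"

definition free_gen :: "'a \<Rightarrow> 'a word" where
  "free_gen x = [(x, True)]"

definition free_lift :: "('h, 'k) monoid_scheme \<Rightarrow> ('a \<Rightarrow> 'h) \<Rightarrow> 'a word \<Rightarrow> 'h" where
  "free_lift H f w =
     foldr (\<lambda>a y. (if snd a then f (fst a) else inv\<^bsub>H\<^esub> (f (fst a))) \<otimes>\<^bsub>H\<^esub> y) w \<one>\<^bsub>H\<^esub>"

lemma reduced_ConsD: "reduced (a # w) \<Longrightarrow> reduced w"
  by (cases w) auto

lemma reduced_left_mult: "reduced w \<Longrightarrow> reduced (left_mult a w)"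
  by (cases w) (auto dest: reduced_ConsD)

lemma set_left_mult: "set (left_mult a w) \<subseteq> insert a (set w)"
  by (cases w) auto

lemma reduced_mult: "reduced v \<Longrightarrow> reduced (foldr left_mult u v)"
  by (induction u) (auto intro: reduced_left_mult)

lemma set_mult: "set (foldr left_mult u v) \<subseteq> set u \<union> set v"
proof (induction u)
  case (Cons a u)
  then show ?case using set_left_mult[of a "foldr left_mult u v"] by auto
qed simp

lemma left_mult_opposite:
  assumes "opposite a b" "reduced w"
  shows "left_mult a (left_mult b w) = w"
proof (cases w)
  case Nil
  then show ?thesis using assms by simp
next
  case (Cons c v)
  show ?thesis
  proof (cases "opposite b c")
    case True
    then have "c = a" using assms by (auto simp: opposite_def prod_eq_iff)
    then show ?thesis using assms True Cons by (cases v) auto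
  next
    case False
    then show ?thesis using assms Cons by simp
  qed
qed

lemma left_mult_assoc:
  assumes "reduced v"
  shows "foldr left_mult (left_mult a u) v = left_mult a (foldr left_mult u v)"
  using assms by (cases u) (auto simp: left_mult_opposite reduced_mult)

lemma word_mult_assoc:
  assumes "reduced w"
  shows "foldr left_mult (foldr left_mult u v) w = foldr left_mult u (foldr left_mult v w)"
  using assms by (induction u) (auto simp: left_mult_assoc)

lemma word_mult_Nil: "reduced w \<Longrightarrow> foldr left_mult w [] = w"
proof (induction w)
  case (Cons a w)
  then show ?case by (cases w) auto
qed simp

lemma word_left_inverse:
  "reduced w \<Longrightarrow> fst ` set w \<subseteq> X \<Longrightarrow>
     \<exists>v. reduced v \<and> fst ` set v \<subseteq> X \<and> foldr left_mult v w = []"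
proof (induction w)
  case (Cons a w)
  then obtain v where v: "reduced v" "fst ` set v \<subseteq> X" "foldr left_mult v w = []"
    using reduced_ConsD[of a w] by auto
  let ?b = "(fst a, \<not> snd a)"
  have b: "opposite ?b a" by (simp add: opposite_def)
  have "foldr left_mult (foldr left_mult v [?b]) (a # w) = []"
    using Cons.prems b v by (simp add: word_mult_assoc)
  moreover have "fst ` set (foldr left_mult v [?b]) \<subseteq> X"
    using set_mult[of v "[?b]"] v(2) Cons.prems(2) by force
  moreover have "reduced (foldr left_mult v [?b])"
    by (rule reduced_mult) simp
  ultimately show ?case by blast
qed (rule exI[of _ "[]"], simp)

lemma group_free_group: "group (free_group X)"
proof (rule groupI)
  fix u v assume "u \<in> carrier (free_group X)" "v \<in> carrier (free_group X)"
  then show "u \<otimes>\<^bsub>free_group X\<^esub> v \<in> carrier (free_group X)"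
    using set_mult[of u v] by (fastforce simp: free_group_def reduced_mult)
qed (auto simp: free_group_def word_mult_assoc word_left_inverse)

lemma free_gen_closed: "x \<in> X \<Longrightarrow> free_gen x \<in> carrier (free_group X)"
  by (simp add: free_group_def free_gen_def)

lemma free_lift_letter:
  assumes "group H" "f \<in> X \<rightarrow> carrier H" "fst a \<in> X"
  shows "(if snd a then f (fst a) else inv\<^bsub>H\<^esub> (f (fst a))) \<in> carrier H"
  using assms by (auto intro: group.inv_closed)

lemma free_lift_closed:
  assumes "group H" "f \<in> X \<rightarrow> carrier H"
  shows "fst ` set w \<subseteq> X \<Longrightarrow> free_lift H f w \<in> carrier H"
proof (induction w)
  case Nil
  interpret group H by fact
  show ?case by (simp add: free_lift_def)
next
  case (Cons a w)
  interpret group H by fact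
  show ?case using Cons free_lift_letter[OF assms, of a] by (simp add: free_lift_def)
qed

lemma free_lift_left_mult:
  assumes "group H" "f \<in> X \<rightarrow> carrier H" "fst ` set w \<subseteq> X" "fst a \<in> X"
  shows "free_lift H f (left_mult a w) =
    (if snd a then f (fst a) else inv\<^bsub>H\<^esub> (f (fst a))) \<otimes>\<^bsub>H\<^esub> free_lift H f w"
proof (cases w)
  case (Cons b v)
  interpret group H by fact
  have c: "f (fst b) \<in> carrier H" "free_lift H f v \<in> carrier H"
    using assms Cons by (auto intro: free_lift_closed)
  show ?thesis
  proof (cases "opposite a b")
    case True
    then have "fst a = fst b" "snd a = (\<not> snd b)" by (auto simp: opposite_def)
    then show ?thesis using True Cons c
      by (auto simp: free_lift_def simp flip: m_assoc)
  qed (use Cons in \<open>simp add: free_lift_def\<close>)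
qed (simp add: free_lift_def)

lemma free_lift_hom:
  assumes "group H" "f \<in> X \<rightarrow> carrier H"
  shows "free_lift H f \<in> hom (free_group X) H"
proof (rule homI)
  interpret group H by fact
  fix u v
  assume uv: "u \<in> carrier (free_group X)" "v \<in> carrier (free_group X)"
  then have v: "fst ` set v \<subseteq> X" and u: "fst ` set u \<subseteq> X" by (auto simp: free_group_def)
  show "free_lift H f u \<in> carrier H" using u by (rule free_lift_closed[OF assms])
  show "free_lift H f (u \<otimes>\<^bsub>free_group X\<^esub> v) = free_lift H f u \<otimes>\<^bsub>H\<^esub> free_lift H f v"
    using u
  proof (induction u)
    case Nil
    then show ?case using v free_lift_closed[OF assms]
      by (simp add: free_lift_def free_group_def)
  next
    case (Cons a u)
    have "fst ` set (foldr left_mult u v) \<subseteq> X" using set_mult[of u v] Cons.prems v by fastforce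
    then have "free_lift H f ((a # u) \<otimes>\<^bsub>free_group X\<^esub> v) =
      (if snd a then f (fst a) else inv\<^bsub>H\<^esub> (f (fst a))) \<otimes>\<^bsub>H\<^esub> (free_lift H f u \<otimes>\<^bsub>H\<^esub> free_lift H f v)"
      using Cons by (simp add: free_group_def free_lift_left_mult[OF assms])
    also have "\<dots> = free_lift H f (a # u) \<otimes>\<^bsub>H\<^esub> free_lift H f v"
      using Cons.prems v free_lift_letter[OF assms, of a] free_lift_closed[OF assms]
      by (simp add: free_lift_def m_assoc)
    finally show ?case .
  qed
qed

lemma free_lift_gen:
  "group H \<Longrightarrow> f x \<in> carrier H \<Longrightarrow> free_lift H f (free_gen x) = f x"
  by (simp add: free_lift_def free_gen_def group.is_monoid)

lemma free_group_induct [consumes 1, case_names one gen inv mult]: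
  assumes w: "w \<in> carrier (free_group X)"
    and one: "P \<one>\<^bsub>free_group X\<^esub>"
    and gen: "\<And>x. x \<in> X \<Longrightarrow> P (free_gen x)"
    and inv: "\<And>u. u \<in> carrier (free_group X) \<Longrightarrow> P u \<Longrightarrow> P (inv\<^bsub>free_group X\<^esub> u)"
    and mult: "\<And>u v. u \<in> carrier (free_group X) \<Longrightarrow> v \<in> carrier (free_group X) \<Longrightarrow> P u \<Longrightarrow> P v
      \<Longrightarrow> P (u \<otimes>\<^bsub>free_group X\<^esub> v)"
  shows "P w"
  using w
proof (induction w)
  case Nil
  then show ?case using one by (simp add: free_group_def)
next
  case (Cons a w)
  have w: "w \<in> carrier (free_group X)" and a: "fst a \<in> X"
    using Cons.prems by (auto simp: free_group_def dest: reduced_ConsD)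
  have ac: "[a] \<in> carrier (free_group X)" using a by (simp add: free_group_def)
  have "P [a]"
  proof (cases "snd a")
    case True
    then have "free_gen (fst a) = [a]" by (simp add: free_gen_def prod_eq_iff)
    then show ?thesis using gen[OF a] by simp
  next
    case False
    have "[a] \<otimes>\<^bsub>free_group X\<^esub> free_gen (fst a) = \<one>\<^bsub>free_group X\<^esub>"
      using False by (simp add: free_group_def free_gen_def opposite_def)
    then have "inv\<^bsub>free_group X\<^esub> (free_gen (fst a)) = [a]"
      using group.inv_equality[OF group_free_group _ free_gen_closed[OF a] ac] by blast
    then show ?thesis using inv[OF free_gen_closed[OF a] gen[OF a]] by simp
  qed
  moreover have "a # w = [a] \<otimes>\<^bsub>free_group X\<^esub> w"
    using Cons.prems by (cases w) (auto simp: free_group_def)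
  ultimately show ?case using mult[OF ac w _ Cons.IH[OF w]] by simp
qed

lemma free_group_hom_unique:
  assumes "group H" "h \<in> hom (free_group X) H" "h' \<in> hom (free_group X) H"
    and "\<And>x. x \<in> X \<Longrightarrow> h (free_gen x) = h' (free_gen x)"
    and "w \<in> carrier (free_group X)"
  shows "h w = h' w"
proof -
  interpret h: group_hom "free_group X" H h
    using assms group_free_group by (simp add: group_hom_def group_hom_axioms_def)
  interpret h': group_hom "free_group X" H h'
    using assms group_free_group by (simp add: group_hom_def group_hom_axioms_def)
  from assms(5) show ?thesis
    by (induction rule: free_group_induct) (use assms(4) in auto)
qed

theorem free_group_universal:
  assumes "group H" "f \<in> X \<rightarrow> carrier H"
  shows "\<exists>h \<in> hom (free_group X) H. (\<forall>x\<in>X. h (free_gen x) = f x) \<and>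
    (\<forall>h' \<in> hom (free_group X) H. (\<forall>x\<in>X. h' (free_gen x) = f x) \<longrightarrow>
       (\<forall>w \<in> carrier (free_group X). h' w = h w))"
proof (intro bexI[of _ "free_lift H f"] conjI ballI impI)
  fix x assume "x \<in> X"
  then show "free_lift H f (free_gen x) = f x"
    using assms by (auto intro: free_lift_gen)
next
  fix h' w
  assume h': "h' \<in> hom (free_group X) H" "\<forall>x\<in>X. h' (free_gen x) = f x"
    and w: "w \<in> carrier (free_group X)"
  show "h' w = free_lift H f w"
  proof (rule free_group_hom_unique[OF assms(1) h'(1) free_lift_hom[OF assms] _ w])
    fix x assume "x \<in> X"
    then show "h' (free_gen x) = free_lift H f (free_gen x)"
      using h'(2) Pi_mem[OF assms(2)] by (simp add: free_lift_gen assms(1))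
  qed
qed (rule free_lift_hom[OF assms])


section \<open>Presentations\<close>

definition normal_closure :: "('a, 'b) monoid_scheme \<Rightarrow> 'a set \<Rightarrow> 'a set" where
  "normal_closure G S = \<Inter> {N. N \<lhd> G \<and> S \<subseteq> N}"

definition presentation ::
  "('g, 'k) monoid_scheme \<Rightarrow> 'x set \<Rightarrow> 'r set \<Rightarrow> ('r \<Rightarrow> 'x word) \<Rightarrow> ('x word \<Rightarrow> 'g) \<Rightarrow> bool" where
  "presentation G X R \<omega> \<phi> \<longleftrightarrow>
     group G \<and> \<omega> \<in> R \<rightarrow> carrier (free_group X) \<and> \<phi> \<in> epi (free_group X) G \<and>
     kernel (free_group X) G \<phi> = normal_closure (free_group X) (\<omega> ` R)"

lemma normal_closure_normal:
  assumes "group G" "S \<subseteq> carrier G"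
  shows "normal_closure G S \<lhd> G"
proof -
  interpret group G by fact
  have c: "carrier G \<in> {N. N \<lhd> G \<and> S \<subseteq> N}"
    using assms by (auto simp: normal_inv_iff subgroup_self)
  have "subgroup (normal_closure G S) G"
    unfolding normal_closure_def using c
    by (intro subgroups_Inter) (auto dest: normal_imp_subgroup)
  moreover have "x \<otimes>\<^bsub>G\<^esub> h \<otimes>\<^bsub>G\<^esub> inv\<^bsub>G\<^esub> x \<in> normal_closure G S"
    if "x \<in> carrier G" "h \<in> normal_closure G S" for x h
    using that by (auto simp: normal_closure_def normal_inv_iff)
  ultimately show ?thesis by (simp add: normal_inv_iff)
qed

lemma normal_closure_superset: "S \<subseteq> normal_closure G S"
  by (auto simp: normal_closure_def)

lemma normal_closure_minimal: "N \<lhd> G \<Longrightarrow> S \<subseteq> N \<Longrightarrow> normal_closure G S \<subseteq> N"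
  by (auto simp: normal_closure_def)


section \<open>Groupoids\<close>

text \<open>Composition is written in diagrammatic order: \<open>Comp \<Phi> a b\<close> is first \<open>a\<close>, then \<open>b\<close>.\<close>

record ('o, 'a) groupoid =
  Obj :: "'o set"
  Arr :: "'a set"
  Src :: "'a \<Rightarrow> 'o"
  Tgt :: "'a \<Rightarrow> 'o"
  Comp :: "'a \<Rightarrow> 'a \<Rightarrow> 'a"
  Ident :: "'o \<Rightarrow> 'a"

definition Homset :: "('o, 'a, 'z) groupoid_scheme \<Rightarrow> 'o \<Rightarrow> 'o \<Rightarrow> 'a set" where
  "Homset \<Phi> x y = {u \<in> Arr \<Phi>. Src \<Phi> u = x \<and> Tgt \<Phi> u = y}"

locale groupoid =
  fixes \<Phi> :: "('o, 'a, 'z) groupoid_scheme"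
  assumes Src_closed: "u \<in> Arr \<Phi> \<Longrightarrow> Src \<Phi> u \<in> Obj \<Phi>"
    and Tgt_closed: "u \<in> Arr \<Phi> \<Longrightarrow> Tgt \<Phi> u \<in> Obj \<Phi>"
    and Comp_closed: "u \<in> Homset \<Phi> x y \<Longrightarrow> v \<in> Homset \<Phi> y z \<Longrightarrow> Comp \<Phi> u v \<in> Homset \<Phi> x z"
    and Comp_assoc: "u \<in> Homset \<Phi> x y \<Longrightarrow> v \<in> Homset \<Phi> y z \<Longrightarrow> w \<in> Homset \<Phi> z t \<Longrightarrow>
      Comp \<Phi> (Comp \<Phi> u v) w = Comp \<Phi> u (Comp \<Phi> v w)"
    and Ident_closed: "x \<in> Obj \<Phi> \<Longrightarrow> Ident \<Phi> x \<in> Homset \<Phi> x x"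
    and Ident_left: "u \<in> Homset \<Phi> x y \<Longrightarrow> Comp \<Phi> (Ident \<Phi> x) u = u"
    and Ident_right: "u \<in> Homset \<Phi> x y \<Longrightarrow> Comp \<Phi> u (Ident \<Phi> y) = u"
    and inverse_ex: "u \<in> Homset \<Phi> x y \<Longrightarrow>
      \<exists>v \<in> Homset \<Phi> y x. Comp \<Phi> u v = Ident \<Phi> x \<and> Comp \<Phi> v u = Ident \<Phi> y"

definition Inverse :: "('o, 'a, 'z) groupoid_scheme \<Rightarrow> 'a \<Rightarrow> 'a" where
  "Inverse \<Phi> u = (THE v. v \<in> Homset \<Phi> (Tgt \<Phi> u) (Src \<Phi> u) \<and>
     Comp \<Phi> u v = Ident \<Phi> (Src \<Phi> u) \<and> Comp \<Phi> v u = Ident \<Phi> (Tgt \<Phi> u))"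

definition groupoid_morphism ::
  "('o, 'a, 'y) groupoid_scheme \<Rightarrow> ('p, 'b, 'z) groupoid_scheme \<Rightarrow> ('o \<Rightarrow> 'p) \<Rightarrow> ('a \<Rightarrow> 'b) \<Rightarrow> bool" where
  "groupoid_morphism \<Phi> \<Psi> f0 f1 \<longleftrightarrow>
     (\<forall>x \<in> Obj \<Phi>. f0 x \<in> Obj \<Psi> \<and> f1 (Ident \<Phi> x) = Ident \<Psi> (f0 x)) \<and>
     (\<forall>u \<in> Arr \<Phi>. f1 u \<in> Homset \<Psi> (f0 (Src \<Phi> u)) (f0 (Tgt \<Phi> u))) \<and>
     (\<forall>u \<in> Arr \<Phi>. \<forall>v \<in> Arr \<Phi>. Tgt \<Phi> u = Src \<Phi> v \<longrightarrow> f1 (Comp \<Phi> u v) = Comp \<Psi> (f1 u) (f1 v))"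

definition one_object :: "('h, 'k) monoid_scheme \<Rightarrow> (unit, 'h) groupoid" where
  "one_object H = \<lparr>Obj = {()}, Arr = carrier H, Src = (\<lambda>_. ()), Tgt = (\<lambda>_. ()),
     Comp = monoid.mult H, Ident = (\<lambda>_. \<one>\<^bsub>H\<^esub>)\<rparr>"

text \<open>The free groupoid on the Cayley graph, in its explicit form with arrows
  \<open>(g, u) : g \<rightarrow> g \<phi>(u)\<close> for \<open>u\<close> in the free group \<open>F\<close>.\<close>

definition cayley_groupoid ::
  "('g, 'k) monoid_scheme \<Rightarrow> ('h, 'l) monoid_scheme \<Rightarrow> ('h \<Rightarrow> 'g) \<Rightarrow> ('g, 'g \<times> 'h) groupoid" where
  "cayley_groupoid G F \<phi> = \<lparr>Obj = carrier G, Arr = carrier G \<times> carrier F,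
     Src = fst, Tgt = (\<lambda>(g, u). g \<otimes>\<^bsub>G\<^esub> \<phi> u),
     Comp = (\<lambda>(g, u) (_, v). (g, u \<otimes>\<^bsub>F\<^esub> v)), Ident = (\<lambda>g. (g, \<one>\<^bsub>F\<^esub>))\<rparr>"

lemma (in groupoid) Inverse_eqI:
  assumes "u \<in> Homset \<Phi> x y" "v \<in> Homset \<Phi> y x" "Comp \<Phi> u v = Ident \<Phi> x" "Comp \<Phi> v u = Ident \<Phi> y"
  shows "Inverse \<Phi> u = v"
proof -
  have [simp]: "Src \<Phi> u = x" "Tgt \<Phi> u = y" using assms(1) by (auto simp: Homset_def)
  show ?thesis
    unfolding Inverse_def
  proof (rule the_equality)
    fix v' assume v': "v' \<in> Homset \<Phi> (Tgt \<Phi> u) (Src \<Phi> u) \<and>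
      Comp \<Phi> u v' = Ident \<Phi> (Src \<Phi> u) \<and> Comp \<Phi> v' u = Ident \<Phi> (Tgt \<Phi> u)"
    then have "v' = Comp \<Phi> (Comp \<Phi> v u) v'" using assms Ident_left[of v' y x] by simp
    also have "\<dots> = v" using v' assms Comp_assoc[of v y x u y v' x] Ident_right[of v y x] by simp
    finally show "v' = v" .
  qed (use assms in simp)
qed

lemma one_object_simps [simp]:
  "Obj (one_object H) = {()}" "Comp (one_object H) = monoid.mult H"
  "Ident (one_object H) x = \<one>\<^bsub>H\<^esub>" "Homset (one_object H) x y = carrier H"
  by (auto simp: one_object_def Homset_def)

lemma cayley_groupoid_simps [simp]:
  "Obj (cayley_groupoid G F \<phi>) = carrier G"
  "Comp (cayley_groupoid G F \<phi>) (g, u) (h, v) = (g, u \<otimes>\<^bsub>F\<^esub> v)"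
  "Ident (cayley_groupoid G F \<phi>) g = (g, \<one>\<^bsub>F\<^esub>)"
  "Homset (cayley_groupoid G F \<phi>) g h = {(g, u) | u. g \<in> carrier G \<and> u \<in> carrier F \<and> h = g \<otimes>\<^bsub>G\<^esub> \<phi> u}"
  by (auto simp: cayley_groupoid_def Homset_def)

lemma groupoid_one_object:
  assumes "group H" shows "groupoid (one_object H)"
proof -
  interpret group H by fact
  show ?thesis
  proof (unfold_locales, goal_cases)
    case (8 u x y)
    then show ?case by (intro bexI[of _ "inv\<^bsub>H\<^esub> u"]) (auto simp: one_object_def Homset_def)
  qed (auto simp: one_object_def Homset_def m_assoc)
qed

lemma Inverse_one_object:
  assumes "group H" "u \<in> carrier H" shows "Inverse (one_object H) u = inv\<^bsub>H\<^esub> u"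
proof -
  interpret group H by fact
  show ?thesis
    by (rule groupoid.Inverse_eqI[OF groupoid_one_object[OF assms(1)], of _ "()" "()"])
      (use assms(2) in \<open>auto simp: one_object_def Homset_def\<close>)
qed

lemma groupoid_cayley:
  assumes "group G" "group F" "\<phi> \<in> hom F G" shows "groupoid (cayley_groupoid G F \<phi>)"
proof -
  interpret G: group G by fact
  interpret F: group F by fact
  interpret group_hom F G \<phi> using assms by (simp add: group_hom_def group_hom_axioms_def)
  show ?thesis
  proof (unfold_locales, goal_cases)
    case (8 u x y)
    then show ?case
      by (intro bexI[of _ "(y, inv\<^bsub>F\<^esub> (snd u))"])
        (auto simp: cayley_groupoid_def Homset_def G.m_assoc)
  qed (auto simp: cayley_groupoid_def Homset_def F.m_assoc G.m_assoc)
qed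

lemma Inverse_cayley:
  assumes "group G" "group F" "\<phi> \<in> hom F G" "g \<in> carrier G" "u \<in> carrier F"
  shows "Inverse (cayley_groupoid G F \<phi>) (g, u) = (g \<otimes>\<^bsub>G\<^esub> \<phi> u, inv\<^bsub>F\<^esub> u)"
proof -
  interpret G: group G by fact
  interpret F: group F by fact
  interpret group_hom F G \<phi> using assms by (simp add: group_hom_def group_hom_axioms_def)
  show ?thesis
    by (rule groupoid.Inverse_eqI[OF groupoid_cayley[OF assms(1-3)], of _ g "g \<otimes>\<^bsub>G\<^esub> \<phi> u"])
      (use assms(4,5) in \<open>auto simp: cayley_groupoid_def Homset_def G.m_assoc\<close>)
qed


section \<open>Crossed modules over groupoids\<close>

text \<open>The groups at different objects may overlap, so the boundary takes the object as
  an extra argument. The action does not need it: \<open>Act M m u\<close> is meant for \<open>m\<close> in the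
  group at the source of \<open>u\<close>.\<close>

record ('o, 'a, 'm) xmod =
  Grp :: "'o \<Rightarrow> 'm monoid"
  Bd :: "'o \<Rightarrow> 'm \<Rightarrow> 'a"
  Act :: "'m \<Rightarrow> 'a \<Rightarrow> 'm"

locale crossed_module = groupoid \<Phi>
  for \<Phi> :: "('o, 'a, 'z) groupoid_scheme" +
  fixes M :: "('o, 'a, 'm, 'y) xmod_scheme"
  assumes Grp_group: "x \<in> Obj \<Phi> \<Longrightarrow> group (Grp M x)"
    and Bd_closed: "x \<in> Obj \<Phi> \<Longrightarrow> m \<in> carrier (Grp M x) \<Longrightarrow> Bd M x m \<in> Homset \<Phi> x x"
    and Bd_mult: "x \<in> Obj \<Phi> \<Longrightarrow> m \<in> carrier (Grp M x) \<Longrightarrow> n \<in> carrier (Grp M x) \<Longrightarrow>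
      Bd M x (m \<otimes>\<^bsub>Grp M x\<^esub> n) = Comp \<Phi> (Bd M x m) (Bd M x n)"
    and Act_closed: "u \<in> Homset \<Phi> x y \<Longrightarrow> m \<in> carrier (Grp M x) \<Longrightarrow> Act M m u \<in> carrier (Grp M y)"
    and Act_Ident: "x \<in> Obj \<Phi> \<Longrightarrow> m \<in> carrier (Grp M x) \<Longrightarrow> Act M m (Ident \<Phi> x) = m"
    and Act_Comp: "u \<in> Homset \<Phi> x y \<Longrightarrow> v \<in> Homset \<Phi> y z \<Longrightarrow> m \<in> carrier (Grp M x) \<Longrightarrow>
      Act M (Act M m u) v = Act M m (Comp \<Phi> u v)"
    and Act_mult: "u \<in> Homset \<Phi> x y \<Longrightarrow> m \<in> carrier (Grp M x) \<Longrightarrow> n \<in> carrier (Grp M x) \<Longrightarrow>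
      Act M (m \<otimes>\<^bsub>Grp M x\<^esub> n) u = Act M m u \<otimes>\<^bsub>Grp M y\<^esub> Act M n u"
    and Bd_Act: "u \<in> Homset \<Phi> x y \<Longrightarrow> m \<in> carrier (Grp M x) \<Longrightarrow>
      Bd M y (Act M m u) = Comp \<Phi> (Comp \<Phi> (Inverse \<Phi> u) (Bd M x m)) u"
    and Peiffer: "x \<in> Obj \<Phi> \<Longrightarrow> m \<in> carrier (Grp M x) \<Longrightarrow> n \<in> carrier (Grp M x) \<Longrightarrow>
      inv\<^bsub>Grp M x\<^esub> n \<otimes>\<^bsub>Grp M x\<^esub> m \<otimes>\<^bsub>Grp M x\<^esub> n = Act M m (Bd M x n)"

definition xmod_morphism ::
  "('o, 'a, 'z) groupoid_scheme \<Rightarrow> ('o, 'a, 'm, 'y) xmod_scheme \<Rightarrow> ('o, 'a, 'n, 'w) xmod_scheme \<Rightarrow>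
   ('o \<Rightarrow> 'm \<Rightarrow> 'n) \<Rightarrow> bool" where
  "xmod_morphism \<Phi> M N f \<longleftrightarrow>
     (\<forall>x \<in> Obj \<Phi>. f x \<in> hom (Grp M x) (Grp N x)) \<and>
     (\<forall>x \<in> Obj \<Phi>. \<forall>m \<in> carrier (Grp M x). Bd N x (f x m) = Bd M x m) \<and>
     (\<forall>x y. \<forall>u \<in> Homset \<Phi> x y. \<forall>m \<in> carrier (Grp M x). f y (Act M m u) = Act N (f x m) u)"

text \<open>\<open>M\<close> with the maps \<open>\<iota> x : S x \<rightarrow> M x\<close> is the free crossed module on the family
  \<open>w x : S x \<rightarrow> \<Phi>(x, x)\<close>. A definition cannot quantify over types, so the type in which the
  test objects of the universal property live is an explicit argument; the freeness
  theorems below hold for every such type.\<close>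

definition free_crossed_module ::
  "'n itself \<Rightarrow> ('o, 'a, 'z) groupoid_scheme \<Rightarrow> ('o \<Rightarrow> 's set) \<Rightarrow> ('o \<Rightarrow> 's \<Rightarrow> 'a) \<Rightarrow>
   ('o, 'a, 'm, 'y) xmod_scheme \<Rightarrow> ('o \<Rightarrow> 's \<Rightarrow> 'm) \<Rightarrow> bool" where
  "free_crossed_module (_ :: 'n itself) \<Phi> S w M \<iota> \<longleftrightarrow>
     crossed_module \<Phi> M \<and>
     (\<forall>x \<in> Obj \<Phi>. \<forall>s \<in> S x. \<iota> x s \<in> carrier (Grp M x) \<and> Bd M x (\<iota> x s) = w x s) \<and>
     (\<forall>(N :: ('o, 'a, 'n) xmod) j.
        crossed_module \<Phi> N \<longrightarrow>
        (\<forall>x \<in> Obj \<Phi>. \<forall>s \<in> S x. j x s \<in> carrier (Grp N x) \<and> Bd N x (j x s) = w x s) \<longrightarrow>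
        (\<exists>f. xmod_morphism \<Phi> M N f \<and> (\<forall>x \<in> Obj \<Phi>. \<forall>s \<in> S x. f x (\<iota> x s) = j x s) \<and>
           (\<forall>f'. xmod_morphism \<Phi> M N f' \<and> (\<forall>x \<in> Obj \<Phi>. \<forall>s \<in> S x. f' x (\<iota> x s) = j x s) \<longrightarrow>
              (\<forall>x \<in> Obj \<Phi>. \<forall>m \<in> carrier (Grp M x). f' x m = f x m))))"

text \<open>A family of homomorphisms from \<open>M\<close> to a fixed group which kills the operation of \<open>\<Phi>\<close>.\<close>

definition kills_operation ::
  "('o, 'a, 'z) groupoid_scheme \<Rightarrow> ('o, 'a, 'm, 'y) xmod_scheme \<Rightarrow> ('b, 'k) monoid_scheme \<Rightarrow>
   ('o \<Rightarrow> 'm \<Rightarrow> 'b) \<Rightarrow> bool" where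
  "kills_operation \<Phi> M A k \<longleftrightarrow>
     (\<forall>x \<in> Obj \<Phi>. k x \<in> hom (Grp M x) A) \<and>
     (\<forall>x y. \<forall>u \<in> Homset \<Phi> x y. \<forall>m \<in> carrier (Grp M x). k y (Act M m u) = k x m)"


lemma (in crossed_module) Bd_one:
  assumes "x \<in> Obj \<Phi>" shows "Bd M x \<one>\<^bsub>Grp M x\<^esub> = Ident \<Phi> x"
proof -
  interpret Mx: group "Grp M x" using assms by (rule Grp_group)
  let ?b = "Bd M x \<one>\<^bsub>Grp M x\<^esub>"
  have b: "?b \<in> Homset \<Phi> x x" using assms by (auto intro: Bd_closed)
  obtain v where v: "v \<in> Homset \<Phi> x x" "Comp \<Phi> ?b v = Ident \<Phi> x"
    using inverse_ex[OF b] by blast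
  have "Comp \<Phi> ?b ?b = ?b" using Bd_mult[OF assms, of "\<one>\<^bsub>Grp M x\<^esub>" "\<one>\<^bsub>Grp M x\<^esub>"] by simp
  then have "Comp \<Phi> ?b (Comp \<Phi> ?b v) = Comp \<Phi> ?b v" using Comp_assoc[OF b b v(1)] by simp
  then show ?thesis using v Ident_right[OF b] by simp
qed

lemma (in crossed_module) Bd_inv:
  assumes "x \<in> Obj \<Phi>" "m \<in> carrier (Grp M x)"
  shows "Bd M x (inv\<^bsub>Grp M x\<^esub> m) = Inverse \<Phi> (Bd M x m)"
proof -
  interpret Mx: group "Grp M x" using assms(1) by (rule Grp_group)
  show ?thesis
    by (rule Inverse_eqI[symmetric, of _ x x])
      (use assms in \<open>auto simp: Bd_closed Bd_one simp flip: Bd_mult\<close>)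
qed

lemma (in crossed_module) Act_hom:
  assumes "u \<in> Homset \<Phi> x y"
  shows "(\<lambda>m. Act M m u) \<in> hom (Grp M x) (Grp M y)"
  using assms by (auto intro!: homI Act_closed Act_mult)


section \<open>The free crossed module over a group\<close>

text \<open>The free crossed module on \<open>\<omega> : R \<rightarrow> P\<close> is the quotient of the free group on
  \<open>R \<times> P\<close>, where \<open>(r, p)\<close> stands for \<open>r\<^sup>p\<close>, by the Peiffer relations
  \<open>a\<^sup>-\<^sup>1 b a = b\<^bsup>\<theta> a\<^esup>\<close>. Both \<open>\<theta>\<close> and the action of \<open>p \<in> P\<close> are well defined on
  cosets; they are computed by taking images.\<close>

definition fx_group :: "('p, 'k) monoid_scheme \<Rightarrow> 'r set \<Rightarrow> ('r \<times> 'p) word monoid" where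
  "fx_group P R = free_group (R \<times> carrier P)"

definition fx_bd :: "('p, 'k) monoid_scheme \<Rightarrow> ('r \<Rightarrow> 'p) \<Rightarrow> ('r \<times> 'p) word \<Rightarrow> 'p" where
  "fx_bd P \<omega> = free_lift P (\<lambda>(r, p). inv\<^bsub>P\<^esub> p \<otimes>\<^bsub>P\<^esub> \<omega> r \<otimes>\<^bsub>P\<^esub> p)"

definition fx_act ::
  "('p, 'k) monoid_scheme \<Rightarrow> 'r set \<Rightarrow> 'p \<Rightarrow> ('r \<times> 'p) word \<Rightarrow> ('r \<times> 'p) word" where
  "fx_act P R q = free_lift (fx_group P R) (\<lambda>(r, p). free_gen (r, p \<otimes>\<^bsub>P\<^esub> q))"

definition fx_peiffer :: "('p, 'k) monoid_scheme \<Rightarrow> 'r set \<Rightarrow> ('r \<Rightarrow> 'p) \<Rightarrow> ('r \<times> 'p) word set" where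
  "fx_peiffer P R \<omega> =
     {inv\<^bsub>fx_group P R\<^esub> a \<otimes>\<^bsub>fx_group P R\<^esub> b \<otimes>\<^bsub>fx_group P R\<^esub> a
        \<otimes>\<^bsub>fx_group P R\<^esub> inv\<^bsub>fx_group P R\<^esub> (fx_act P R (fx_bd P \<omega> a) b) | a b.
      a \<in> carrier (fx_group P R) \<and> b \<in> carrier (fx_group P R)}"

definition fx_rel :: "('p, 'k) monoid_scheme \<Rightarrow> 'r set \<Rightarrow> ('r \<Rightarrow> 'p) \<Rightarrow> ('r \<times> 'p) word set" where
  "fx_rel P R \<omega> = normal_closure (fx_group P R) (fx_peiffer P R \<omega>)"

definition free_xmod ::
  "('p, 'k) monoid_scheme \<Rightarrow> 'r set \<Rightarrow> ('r \<Rightarrow> 'p) \<Rightarrow> (unit, 'p, ('r \<times> 'p) word set) xmod" where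
  "free_xmod P R \<omega> = \<lparr>Grp = (\<lambda>_. fx_group P R Mod fx_rel P R \<omega>),
     Bd = (\<lambda>_ c. the_elem (fx_bd P \<omega> ` c)),
     Act = (\<lambda>c q. fx_act P R q ` c)\<rparr>"

definition free_xmod_gen ::
  "('p, 'k) monoid_scheme \<Rightarrow> 'r set \<Rightarrow> ('r \<Rightarrow> 'p) \<Rightarrow> 'r \<Rightarrow> ('r \<times> 'p) word set" where
  "free_xmod_gen P R \<omega> r = fx_rel P R \<omega> #>\<^bsub>fx_group P R\<^esub> free_gen (r, \<one>\<^bsub>P\<^esub>)"

lemma the_elem_coset:
  assumes "N \<lhd> H" "group K" "h \<in> hom H K" "\<And>n. n \<in> N \<Longrightarrow> h n = \<one>\<^bsub>K\<^esub>" "w \<in> carrier H"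
  shows "the_elem (h ` (N #>\<^bsub>H\<^esub> w)) = h w"
proof -
  interpret normal N H by fact
  interpret h: group_hom H K h
    using assms is_group by (simp add: group_hom_def group_hom_axioms_def)
  have "h ` (N #>\<^bsub>H\<^esub> w) = {h w}"
  proof -
    have "h x = h w" if "x \<in> N #>\<^bsub>H\<^esub> w" for x
      using that assms(4,5) mem_carrier by (auto simp: r_coset_def)
    moreover have "w \<in> N #>\<^bsub>H\<^esub> w" using assms(5) by (simp add: rcos_self is_subgroup)
    ultimately show ?thesis by blast
  qed
  then show ?thesis by simp
qed

locale free_xmod_data = P: group P for P :: "('p, 'k) monoid_scheme" +
  fixes R :: "'r set" and \<omega> :: "'r \<Rightarrow> 'p"
  assumes \<omega>_closed: "r \<in> R \<Longrightarrow> \<omega> r \<in> carrier P"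
begin

abbreviation "H \<equiv> fx_group P R"
abbreviation "\<theta> \<equiv> fx_bd P \<omega>"
abbreviation "\<alpha> \<equiv> fx_act P R"
abbreviation "N \<equiv> fx_rel P R \<omega>"

sublocale H: group H
  by (simp add: fx_group_def group_free_group)

lemma gen_closed: "r \<in> R \<Longrightarrow> p \<in> carrier P \<Longrightarrow> free_gen (r, p) \<in> carrier H"
  by (simp add: fx_group_def free_gen_closed)

sublocale \<theta>: group_hom H P \<theta>
proof
  show "\<theta> \<in> hom H P" unfolding fx_bd_def fx_group_def
    by (rule free_lift_hom) (auto simp: \<omega>_closed)
qed

lemma \<theta>_gen: "r \<in> R \<Longrightarrow> p \<in> carrier P \<Longrightarrow> \<theta> (free_gen (r, p)) = inv\<^bsub>P\<^esub> p \<otimes>\<^bsub>P\<^esub> \<omega> r \<otimes>\<^bsub>P\<^esub> p"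
  unfolding fx_bd_def by (subst free_lift_gen) (auto simp: \<omega>_closed)

lemma \<alpha>_hom: "q \<in> carrier P \<Longrightarrow> \<alpha> q \<in> hom H H"
  unfolding fx_act_def
  by (subst (2) fx_group_def, rule free_lift_hom) (auto simp: gen_closed)

lemma \<alpha>_group_hom: "q \<in> carrier P \<Longrightarrow> group_hom H H (\<alpha> q)"
  by unfold_locales (rule \<alpha>_hom)

lemma \<alpha>_closed: "q \<in> carrier P \<Longrightarrow> w \<in> carrier H \<Longrightarrow> \<alpha> q w \<in> carrier H"
  using \<alpha>_hom by (auto simp: hom_def)

lemma \<alpha>_gen:
  "r \<in> R \<Longrightarrow> p \<in> carrier P \<Longrightarrow> q \<in> carrier P \<Longrightarrow> \<alpha> q (free_gen (r, p)) = free_gen (r, p \<otimes>\<^bsub>P\<^esub> q)"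
  unfolding fx_act_def by (subst free_lift_gen) (auto simp: gen_closed)

lemma H_hom_unique:
  assumes "group K" "h \<in> hom H K" "h' \<in> hom H K"
    and "\<And>r p. r \<in> R \<Longrightarrow> p \<in> carrier P \<Longrightarrow> h (free_gen (r, p)) = h' (free_gen (r, p))"
    and "w \<in> carrier H"
  shows "h w = h' w"
proof (rule free_group_hom_unique[OF assms(1) assms(2,3)[unfolded fx_group_def] _ assms(5)[unfolded fx_group_def]])
  fix x assume "x \<in> R \<times> carrier P"
  then show "h (free_gen x) = h' (free_gen x)" by (cases x) (simp add: assms(4))
qed

lemma \<alpha>_one: "w \<in> carrier H \<Longrightarrow> \<alpha> \<one>\<^bsub>P\<^esub> w = w"
  by (rule H_hom_unique[of H "\<alpha> \<one>\<^bsub>P\<^esub>" "\<lambda>w. w"])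
    (auto simp: \<alpha>_hom \<alpha>_gen H.is_group intro: homI)

lemma \<alpha>_mult:
  assumes "p \<in> carrier P" "q \<in> carrier P" "w \<in> carrier H"
  shows "\<alpha> q (\<alpha> p w) = \<alpha> (p \<otimes>\<^bsub>P\<^esub> q) w"
proof -
  have "(\<alpha> q \<circ> \<alpha> p) w = \<alpha> (p \<otimes>\<^bsub>P\<^esub> q) w"
    by (rule H_hom_unique[OF H.is_group hom_compose[OF \<alpha>_hom \<alpha>_hom] \<alpha>_hom])
      (use assms in \<open>auto simp: \<alpha>_gen P.m_assoc\<close>)
  then show ?thesis by simp
qed

lemma \<theta>_\<alpha>:
  assumes "q \<in> carrier P" "w \<in> carrier H"
  shows "\<theta> (\<alpha> q w) = inv\<^bsub>P\<^esub> q \<otimes>\<^bsub>P\<^esub> \<theta> w \<otimes>\<^bsub>P\<^esub> q"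
proof -
  have c: "(\<lambda>x. inv\<^bsub>P\<^esub> q \<otimes>\<^bsub>P\<^esub> x \<otimes>\<^bsub>P\<^esub> q) \<in> hom P P"
  proof (rule homI)
    fix x y assume "x \<in> carrier P" "y \<in> carrier P"
    then show "inv\<^bsub>P\<^esub> q \<otimes>\<^bsub>P\<^esub> (x \<otimes>\<^bsub>P\<^esub> y) \<otimes>\<^bsub>P\<^esub> q =
      inv\<^bsub>P\<^esub> q \<otimes>\<^bsub>P\<^esub> x \<otimes>\<^bsub>P\<^esub> q \<otimes>\<^bsub>P\<^esub> (inv\<^bsub>P\<^esub> q \<otimes>\<^bsub>P\<^esub> y \<otimes>\<^bsub>P\<^esub> q)"
      using assms(1) by (simp add: P.m_assoc) (simp add: P.m_assoc[symmetric])
  qed (use assms in auto)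
  have "(\<theta> \<circ> \<alpha> q) w = ((\<lambda>x. inv\<^bsub>P\<^esub> q \<otimes>\<^bsub>P\<^esub> x \<otimes>\<^bsub>P\<^esub> q) \<circ> \<theta>) w"
    by (rule H_hom_unique[OF P.is_group hom_compose[OF \<alpha>_hom \<theta>.homh] hom_compose[OF \<theta>.homh c]])
      (use assms in \<open>auto simp: \<alpha>_gen \<theta>_gen P.inv_mult_group P.m_assoc \<omega>_closed\<close>)
  then show ?thesis by simp
qed

lemma peiffer_closed: "fx_peiffer P R \<omega> \<subseteq> carrier H"
  by (auto simp: fx_peiffer_def \<alpha>_closed)

lemma N_normal: "N \<lhd> H"
  unfolding fx_rel_def by (rule normal_closure_normal[OF H.is_group peiffer_closed])

sublocale N: normal N H
  by (rule N_normal)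

lemma N_trivial:
  assumes "group K" "h \<in> hom H K"
    and "\<And>a b. a \<in> carrier H \<Longrightarrow> b \<in> carrier H \<Longrightarrow>
      inv\<^bsub>K\<^esub> (h a) \<otimes>\<^bsub>K\<^esub> h b \<otimes>\<^bsub>K\<^esub> h a = h (\<alpha> (\<theta> a) b)"
    and "n \<in> N"
  shows "h n = \<one>\<^bsub>K\<^esub>"
proof -
  interpret K: group K by fact
  interpret h: group_hom H K h by unfold_locales fact
  have "fx_peiffer P R \<omega> \<subseteq> kernel H K h"
    using assms(3) by (auto simp: fx_peiffer_def kernel_def \<alpha>_closed)
  then have "N \<subseteq> kernel H K h"
    unfolding fx_rel_def by (rule normal_closure_minimal[OF h.normal_kernel])
  then show ?thesis using assms(4) by (auto simp: kernel_def)
qed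

sublocale Q: group "H Mod N"
  by (rule N.factorgroup_is_group)

lemma coset_hom: "(\<lambda>w. N #>\<^bsub>H\<^esub> w) \<in> hom H (H Mod N)"
  by (rule N.r_coset_hom_Mod)

lemma coset_Peiffer:
  assumes "a \<in> carrier H" "b \<in> carrier H"
  shows "N #>\<^bsub>H\<^esub> (inv\<^bsub>H\<^esub> a \<otimes>\<^bsub>H\<^esub> b \<otimes>\<^bsub>H\<^esub> a) = N #>\<^bsub>H\<^esub> \<alpha> (\<theta> a) b"
proof -
  let ?x = "inv\<^bsub>H\<^esub> a \<otimes>\<^bsub>H\<^esub> b \<otimes>\<^bsub>H\<^esub> a" and ?y = "\<alpha> (\<theta> a) b"
  have c: "?x \<in> carrier H" "?y \<in> carrier H" using assms by (auto simp: \<alpha>_closed)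
  have "?x \<otimes>\<^bsub>H\<^esub> inv\<^bsub>H\<^esub> ?y \<in> fx_peiffer P R \<omega>"
    unfolding fx_peiffer_def using assms by blast
  then have "?x \<otimes>\<^bsub>H\<^esub> inv\<^bsub>H\<^esub> ?y \<in> N"
    unfolding fx_rel_def by (rule subsetD[OF normal_closure_superset])
  then have "?x \<in> N #>\<^bsub>H\<^esub> ?y"
    using c by (auto simp: r_coset_def H.m_assoc intro!: bexI[of _ "?x \<otimes>\<^bsub>H\<^esub> inv\<^bsub>H\<^esub> ?y"])
  then show ?thesis
    using c(2) N.is_subgroup by (metis H.repr_independence)
qed

lemma N_\<theta>: "n \<in> N \<Longrightarrow> \<theta> n = \<one>\<^bsub>P\<^esub>"
  by (rule N_trivial[OF P.is_group \<theta>.homh]) (auto simp: \<theta>_\<alpha>)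

lemma \<alpha>_N:
  assumes "q \<in> carrier P" "n \<in> N" shows "\<alpha> q n \<in> N"
proof -
  interpret aq: group_hom H H "\<alpha> q" by (rule \<alpha>_group_hom[OF assms(1)])
  have "((\<lambda>w. N #>\<^bsub>H\<^esub> w) \<circ> \<alpha> q) n = \<one>\<^bsub>H Mod N\<^esub>"
  proof (rule N_trivial[OF Q.is_group _ _ assms(2)])
    fix a b assume ab: "a \<in> carrier H" "b \<in> carrier H"
    have "N #>\<^bsub>H\<^esub> (inv\<^bsub>H\<^esub> (\<alpha> q a) \<otimes>\<^bsub>H\<^esub> \<alpha> q b \<otimes>\<^bsub>H\<^esub> \<alpha> q a) = N #>\<^bsub>H\<^esub> \<alpha> (\<theta> (\<alpha> q a)) (\<alpha> q b)"
      using ab by (intro coset_Peiffer) auto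
    also have "\<alpha> (\<theta> (\<alpha> q a)) (\<alpha> q b) = \<alpha> q (\<alpha> (\<theta> a) b)"
      using ab assms(1) by (simp add: \<alpha>_mult \<theta>_\<alpha>) (simp add: P.m_assoc[symmetric])
    finally show "inv\<^bsub>H Mod N\<^esub> ((\<lambda>w. N #>\<^bsub>H\<^esub> w) \<circ> \<alpha> q) a \<otimes>\<^bsub>H Mod N\<^esub> ((\<lambda>w. N #>\<^bsub>H\<^esub> w) \<circ> \<alpha> q) b
        \<otimes>\<^bsub>H Mod N\<^esub> ((\<lambda>w. N #>\<^bsub>H\<^esub> w) \<circ> \<alpha> q) a = ((\<lambda>w. N #>\<^bsub>H\<^esub> w) \<circ> \<alpha> q) (\<alpha> (\<theta> a) b)"
      using ab by (simp add: N.inv_FactGroup carrier_FactGroup N.rcos_inv N.rcos_sum)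
  qed (rule hom_compose[OF aq.homh coset_hom])
  moreover have "n \<in> carrier H" using assms(2) by (rule N.mem_carrier)
  ultimately show ?thesis
    using H.rcos_self[OF _ N.is_subgroup, of "\<alpha> q n"] by simp
qed

lemma \<alpha>_coset:
  assumes q: "q \<in> carrier P" and w: "w \<in> carrier H"
  shows "\<alpha> q ` (N #>\<^bsub>H\<^esub> w) = N #>\<^bsub>H\<^esub> \<alpha> q w"
proof (intro subset_antisym subsetI)
  interpret aq: group_hom H H "\<alpha> q" by (rule \<alpha>_group_hom[OF q])
  show "x \<in> N #>\<^bsub>H\<^esub> \<alpha> q w" if "x \<in> \<alpha> q ` (N #>\<^bsub>H\<^esub> w)" for x
    using that w \<alpha>_N[OF q] N.mem_carrier by (auto simp: r_coset_def)
  show "x \<in> \<alpha> q ` (N #>\<^bsub>H\<^esub> w)" if "x \<in> N #>\<^bsub>H\<^esub> \<alpha> q w" for x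
  proof -
    obtain n where n: "n \<in> N" "x = n \<otimes>\<^bsub>H\<^esub> \<alpha> q w" using \<open>x \<in> _\<close> by (auto simp: r_coset_def)
    let ?n = "\<alpha> (inv\<^bsub>P\<^esub> q) n"
    have "?n \<in> N" using n q by (simp add: \<alpha>_N)
    moreover have "\<alpha> q (?n \<otimes>\<^bsub>H\<^esub> w) = x"
      using n q w N.mem_carrier by (simp add: \<alpha>_closed \<alpha>_mult \<alpha>_one)
    ultimately show ?thesis by (force simp: r_coset_def)
  qed
qed

abbreviation "C \<equiv> free_xmod P R \<omega>"
abbreviation "\<iota> \<equiv> free_xmod_gen P R \<omega>"

lemma C_carrier: "carrier (Grp C x) = (\<lambda>w. N #>\<^bsub>H\<^esub> w) ` carrier H"
  by (simp add: free_xmod_def carrier_FactGroup)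

lemma C_Bd: "w \<in> carrier H \<Longrightarrow> Bd C x (N #>\<^bsub>H\<^esub> w) = \<theta> w"
  by (simp add: free_xmod_def the_elem_coset[OF N_normal P.is_group \<theta>.homh N_\<theta>])

lemma C_Act: "w \<in> carrier H \<Longrightarrow> q \<in> carrier P \<Longrightarrow> Act C (N #>\<^bsub>H\<^esub> w) q = N #>\<^bsub>H\<^esub> \<alpha> q w"
  by (simp add: free_xmod_def \<alpha>_coset)

lemma C_mult: "a \<in> carrier H \<Longrightarrow> b \<in> carrier H \<Longrightarrow>
    (N #>\<^bsub>H\<^esub> a) \<otimes>\<^bsub>Grp C x\<^esub> (N #>\<^bsub>H\<^esub> b) = N #>\<^bsub>H\<^esub> (a \<otimes>\<^bsub>H\<^esub> b)"
  by (simp add: free_xmod_def N.rcos_sum)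

lemma C_inv: "a \<in> carrier H \<Longrightarrow> inv\<^bsub>Grp C x\<^esub> (N #>\<^bsub>H\<^esub> a) = N #>\<^bsub>H\<^esub> (inv\<^bsub>H\<^esub> a)"
  by (simp add: free_xmod_def N.inv_FactGroup carrier_FactGroup N.rcos_inv)

lemma crossed_module_C: "crossed_module (one_object P) C"
proof -
  show ?thesis
  proof (intro crossed_module.intro crossed_module_axioms.intro, goal_cases)
    case 1
    show ?case by (rule groupoid_one_object[OF P.is_group])
  next
    case (2 x)
    have "Grp C x = H Mod N" by (simp add: free_xmod_def)
    then show ?case using Q.is_group by simp
  next
    case (9 u x y m)
    then show ?case
      by (auto simp: C_carrier C_Act C_Bd \<alpha>_closed \<theta>_\<alpha> Inverse_one_object[OF P.is_group])
  qed (auto simp: C_carrier C_Bd C_Act C_mult C_inv \<alpha>_closed \<alpha>_one \<alpha>_mult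
      coset_Peiffer group_hom.hom_mult[OF \<alpha>_group_hom])
qed

lemma \<iota>_closed: "r \<in> R \<Longrightarrow> \<iota> r \<in> carrier (Grp C x)"
  by (auto simp: free_xmod_gen_def C_carrier gen_closed)

lemma \<iota>_Bd: "r \<in> R \<Longrightarrow> Bd C x (\<iota> r) = \<omega> r"
  by (simp add: free_xmod_gen_def C_Bd gen_closed \<theta>_gen \<omega>_closed)

lemma \<iota>_Act: "r \<in> R \<Longrightarrow> p \<in> carrier P \<Longrightarrow> Act C (\<iota> r) p = N #>\<^bsub>H\<^esub> free_gen (r, p)"
  by (simp add: free_xmod_gen_def C_Act gen_closed \<alpha>_gen)

lemma C_hom_unique:
  assumes "group K" "h \<in> hom (Grp C x) K" "h' \<in> hom (Grp C x) K"
    and "\<And>r p. r \<in> R \<Longrightarrow> p \<in> carrier P \<Longrightarrow> h (Act C (\<iota> r) p) = h' (Act C (\<iota> r) p)"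
    and "c \<in> carrier (Grp C x)"
  shows "h c = h' c"
proof -
  have q: "(\<lambda>w. N #>\<^bsub>H\<^esub> w) \<in> hom H (Grp C x)" using coset_hom by (simp add: free_xmod_def)
  obtain w where w: "w \<in> carrier H" "c = N #>\<^bsub>H\<^esub> w" using assms(5) by (auto simp: C_carrier)
  have "(h \<circ> (\<lambda>w. N #>\<^bsub>H\<^esub> w)) w = (h' \<circ> (\<lambda>w. N #>\<^bsub>H\<^esub> w)) w"
    by (rule H_hom_unique[OF assms(1) hom_compose[OF q assms(2)] hom_compose[OF q assms(3)] _ w(1)])
      (use assms(4) \<iota>_Act in simp)
  then show ?thesis using w by simp
qed

text \<open>The common core of the two freeness theorems: \<open>arr\<close> is a morphism to \<open>\<Phi>\<close> from
  the groupoid with objects \<open>G\<close> and arrows \<open>(g, p) : g \<rightarrow> g \<phi>(p)\<close>.\<close>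

lemma lift_exists:
  fixes K :: "('o, 'a, 'n, 'y) xmod_scheme" and G :: "('g, 'l) monoid_scheme"
  assumes G: "group G" "\<phi> \<in> hom P G" "\<And>r. r \<in> R \<Longrightarrow> \<phi> (\<omega> r) = \<one>\<^bsub>G\<^esub>"
    and K: "crossed_module \<Phi> K"
    and e: "\<And>g. g \<in> carrier G \<Longrightarrow> e g \<in> Obj \<Phi>"
    and arr: "\<And>g p. g \<in> carrier G \<Longrightarrow> p \<in> carrier P \<Longrightarrow> arr g p \<in> Homset \<Phi> (e g) (e (g \<otimes>\<^bsub>G\<^esub> \<phi> p))"
    and arr_one: "\<And>g. g \<in> carrier G \<Longrightarrow> arr g \<one>\<^bsub>P\<^esub> = Ident \<Phi> (e g)"
    and arr_mult: "\<And>g p q. g \<in> carrier G \<Longrightarrow> p \<in> carrier P \<Longrightarrow> q \<in> carrier P \<Longrightarrow>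
      Comp \<Phi> (arr g p) (arr (g \<otimes>\<^bsub>G\<^esub> \<phi> p) q) = arr g (p \<otimes>\<^bsub>P\<^esub> q)"
    and j: "\<And>g r. g \<in> carrier G \<Longrightarrow> r \<in> R \<Longrightarrow> j g r \<in> carrier (Grp K (e g))"
    and Bd_j: "\<And>g r. g \<in> carrier G \<Longrightarrow> r \<in> R \<Longrightarrow> Bd K (e g) (j g r) = arr g (\<omega> r)"
  shows "\<exists>f. (\<forall>g \<in> carrier G. f g \<in> hom (Grp C ()) (Grp K (e g))) \<and>
    (\<forall>g \<in> carrier G. \<forall>c \<in> carrier (Grp C ()). Bd K (e g) (f g c) = arr g (Bd C () c)) \<and>
    (\<forall>g \<in> carrier G. \<forall>c \<in> carrier (Grp C ()). \<forall>p \<in> carrier P.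
       f (g \<otimes>\<^bsub>G\<^esub> \<phi> p) (Act C c p) = Act K (f g c) (arr g p)) \<and>
    (\<forall>g \<in> carrier G. \<forall>r \<in> R. f g (\<iota> r) = j g r)"
proof -
  interpret G: group G by fact
  interpret \<phi>: group_hom P G \<phi> by unfold_locales fact
  interpret K: crossed_module \<Phi> K by fact
  have gr: "group (Grp K (e g))" if "g \<in> carrier G" for g using that e by (simp add: K.Grp_group)
  have shift: "g \<otimes>\<^bsub>G\<^esub> inv\<^bsub>G\<^esub> \<phi> p \<otimes>\<^bsub>G\<^esub> \<phi> p = g" if "g \<in> carrier G" "p \<in> carrier P" for g p
    using that by (simp add: G.m_assoc)
  have arr_inv: "Inverse \<Phi> (arr g p) = arr (g \<otimes>\<^bsub>G\<^esub> \<phi> p) (inv\<^bsub>P\<^esub> p)"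
    if "g \<in> carrier G" "p \<in> carrier P" for g p
  proof (rule K.Inverse_eqI[OF arr[OF that]])
    have *: "g \<otimes>\<^bsub>G\<^esub> \<phi> p \<otimes>\<^bsub>G\<^esub> \<phi> (inv\<^bsub>P\<^esub> p) = g" using that by (simp add: G.m_assoc)
    show "arr (g \<otimes>\<^bsub>G\<^esub> \<phi> p) (inv\<^bsub>P\<^esub> p) \<in> Homset \<Phi> (e (g \<otimes>\<^bsub>G\<^esub> \<phi> p)) (e g)"
      using arr[of "g \<otimes>\<^bsub>G\<^esub> \<phi> p" "inv\<^bsub>P\<^esub> p"] that * by simp
    show "Comp \<Phi> (arr g p) (arr (g \<otimes>\<^bsub>G\<^esub> \<phi> p) (inv\<^bsub>P\<^esub> p)) = Ident \<Phi> (e g)"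
      using that by (simp add: arr_mult arr_one)
    show "Comp \<Phi> (arr (g \<otimes>\<^bsub>G\<^esub> \<phi> p) (inv\<^bsub>P\<^esub> p)) (arr g p) = Ident \<Phi> (e (g \<otimes>\<^bsub>G\<^esub> \<phi> p))"
      using arr_mult[of "g \<otimes>\<^bsub>G\<^esub> \<phi> p" "inv\<^bsub>P\<^esub> p" p] that * by (simp add: arr_one)
  qed
  define k0 where "k0 g = (\<lambda>(r, p). Act K (j (g \<otimes>\<^bsub>G\<^esub> inv\<^bsub>G\<^esub> \<phi> p) r) (arr (g \<otimes>\<^bsub>G\<^esub> inv\<^bsub>G\<^esub> \<phi> p) p))" for g
  define k where "k g = free_lift (Grp K (e g)) (k0 g)" for g
  have arr': "arr (g \<otimes>\<^bsub>G\<^esub> inv\<^bsub>G\<^esub> \<phi> p) p \<in> Homset \<Phi> (e (g \<otimes>\<^bsub>G\<^esub> inv\<^bsub>G\<^esub> \<phi> p)) (e g)"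
    if "g \<in> carrier G" "p \<in> carrier P" for g p
    using arr[of "g \<otimes>\<^bsub>G\<^esub> inv\<^bsub>G\<^esub> \<phi> p" p] that by (simp add: shift)
  have k0: "k0 g \<in> R \<times> carrier P \<rightarrow> carrier (Grp K (e g))" if "g \<in> carrier G" for g
    using that by (auto simp: k0_def intro!: K.Act_closed[OF arr'] j)
  have k_hom: "k g \<in> hom H (Grp K (e g))" if "g \<in> carrier G" for g
    unfolding k_def fx_group_def using that by (intro free_lift_hom gr k0)
  have k_gen: "k g (free_gen (r, p)) = Act K (j (g \<otimes>\<^bsub>G\<^esub> inv\<^bsub>G\<^esub> \<phi> p) r) (arr (g \<otimes>\<^bsub>G\<^esub> inv\<^bsub>G\<^esub> \<phi> p) p)"
    if "g \<in> carrier G" "r \<in> R" "p \<in> carrier P" for g r p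
    using free_lift_gen[OF gr[OF that(1)], of "k0 g" "(r, p)"] funcset_mem[OF k0[OF that(1)], of "(r, p)"] that
    by (simp add: k_def k0_def)
  have k_group_hom: "group_hom H (Grp K (e g)) (k g)" if "g \<in> carrier G" for g
    using that by (simp add: group_hom_def group_hom_axioms_def gr k_hom H.is_group)
  have \<phi>\<theta>: "\<phi> (\<theta> w) = \<one>\<^bsub>G\<^esub>" if "w \<in> carrier H" for w
  proof -
    have "(\<phi> \<circ> \<theta>) w = (\<lambda>_. \<one>\<^bsub>G\<^esub>) w"
      by (rule H_hom_unique[OF G.is_group hom_compose[OF \<theta>.homh \<phi>.homh] _ _ that])
        (auto intro: homI simp: \<theta>_gen \<omega>_closed G(3))
    then show ?thesis by simp
  qed
  have k_Bd: "Bd K (e g) (k g w) = arr g (\<theta> w)" if g: "g \<in> carrier G" and w: "w \<in> carrier H" for g w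
  proof -
    interpret kg: group_hom H "Grp K (e g)" "k g" by (rule k_group_hom[OF g])
    from w show ?thesis unfolding fx_group_def
    proof (induction rule: free_group_induct)
      case one
      then show ?case
        using kg.hom_one \<theta>.hom_one K.Bd_one[OF e[OF g]] arr_one[OF g] by (simp add: fx_group_def)
    next
      case (gen x)
      then obtain r p where x: "x = (r, p)" "r \<in> R" "p \<in> carrier P" by auto
      let ?g = "g \<otimes>\<^bsub>G\<^esub> inv\<^bsub>G\<^esub> \<phi> p"
      have g': "?g \<in> carrier G" using g x by simp
      have "Bd K (e g) (k g (free_gen x)) = Comp \<Phi> (Comp \<Phi> (Inverse \<Phi> (arr ?g p)) (arr ?g (\<omega> r))) (arr ?g p)"
        using x g g' by (simp add: k_gen K.Bd_Act[OF arr'] j Bd_j)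
      also have "Inverse \<Phi> (arr ?g p) = arr g (inv\<^bsub>P\<^esub> p)"
        using arr_inv[OF g' x(3)] g x by (simp add: shift)
      also have "Comp \<Phi> (arr g (inv\<^bsub>P\<^esub> p)) (arr ?g (\<omega> r)) = arr g (inv\<^bsub>P\<^esub> p \<otimes>\<^bsub>P\<^esub> \<omega> r)"
        using arr_mult[of g "inv\<^bsub>P\<^esub> p" "\<omega> r"] g x by (simp add: \<omega>_closed)
      also have "Comp \<Phi> (arr g (inv\<^bsub>P\<^esub> p \<otimes>\<^bsub>P\<^esub> \<omega> r)) (arr ?g p) = arr g (inv\<^bsub>P\<^esub> p \<otimes>\<^bsub>P\<^esub> \<omega> r \<otimes>\<^bsub>P\<^esub> p)"
        using arr_mult[of g "inv\<^bsub>P\<^esub> p \<otimes>\<^bsub>P\<^esub> \<omega> r" p] g x by (simp add: \<omega>_closed G(3))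
      finally show ?case using x by (simp add: \<theta>_gen)
    next
      case (inv u)
      then have u: "u \<in> carrier H" by (simp add: fx_group_def)
      have "Bd K (e g) (k g (inv\<^bsub>H\<^esub> u)) = Inverse \<Phi> (arr g (\<theta> u))"
        using u inv by (simp add: K.Bd_inv[OF e[OF g]])
      also have "\<dots> = arr g (\<theta> (inv\<^bsub>H\<^esub> u))"
        using u g by (simp add: arr_inv \<phi>\<theta>)
      finally show ?case by (simp add: fx_group_def)
    next
      case (mult u v)
      then have uv: "u \<in> carrier H" "v \<in> carrier H" by (simp_all add: fx_group_def)
      have "Bd K (e g) (k g (u \<otimes>\<^bsub>H\<^esub> v)) = Comp \<Phi> (arr g (\<theta> u)) (arr g (\<theta> v))"
        using uv mult by (simp add: K.Bd_mult[OF e[OF g]])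
      also have "\<dots> = arr g (\<theta> (u \<otimes>\<^bsub>H\<^esub> v))"
        using uv g arr_mult[of g "\<theta> u" "\<theta> v"] by (simp add: \<phi>\<theta>)
      finally show ?case by (simp add: fx_group_def)
    qed
  qed
  have k_Act: "k (g \<otimes>\<^bsub>G\<^esub> \<phi> q) (\<alpha> q w) = Act K (k g w) (arr g q)"
    if g: "g \<in> carrier G" and q: "q \<in> carrier P" and w: "w \<in> carrier H" for g q w
  proof -
    have gq: "g \<otimes>\<^bsub>G\<^esub> \<phi> q \<in> carrier G" using g q by simp
    have "(k (g \<otimes>\<^bsub>G\<^esub> \<phi> q) \<circ> \<alpha> q) w = ((\<lambda>m. Act K m (arr g q)) \<circ> k g) w"
    proof (rule H_hom_unique[OF gr[OF gq] hom_compose[OF \<alpha>_hom[OF q] k_hom[OF gq]]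
          hom_compose[OF k_hom[OF g] K.Act_hom[OF arr[OF g q]]] _ w])
      fix r p assume rp: "r \<in> R" "p \<in> carrier P"
      let ?g = "g \<otimes>\<^bsub>G\<^esub> inv\<^bsub>G\<^esub> \<phi> p"
      have g': "?g \<in> carrier G" using g rp by simp
      have "g \<otimes>\<^bsub>G\<^esub> \<phi> q \<otimes>\<^bsub>G\<^esub> inv\<^bsub>G\<^esub> \<phi> (p \<otimes>\<^bsub>P\<^esub> q) = ?g"
        using g q rp by (simp add: G.inv_mult_group G.m_assoc) (simp flip: G.m_assoc)
      then have "k (g \<otimes>\<^bsub>G\<^esub> \<phi> q) (free_gen (r, p \<otimes>\<^bsub>P\<^esub> q)) = Act K (j ?g r) (arr ?g (p \<otimes>\<^bsub>P\<^esub> q))"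
        using k_gen[OF gq rp(1), of "p \<otimes>\<^bsub>P\<^esub> q"] rp q by simp
      also have "arr ?g (p \<otimes>\<^bsub>P\<^esub> q) = Comp \<Phi> (arr ?g p) (arr g q)"
        using arr_mult[OF g' rp(2) q] g rp by (simp add: shift)
      also have "Act K (j ?g r) (Comp \<Phi> (arr ?g p) (arr g q)) = Act K (k g (free_gen (r, p))) (arr g q)"
        using K.Act_Comp[OF arr'[OF g rp(2)] arr[OF g q] j[OF g' rp(1)]] g rp by (simp add: k_gen)
      finally show "(k (g \<otimes>\<^bsub>G\<^esub> \<phi> q) \<circ> \<alpha> q) (free_gen (r, p)) =
          ((\<lambda>m. Act K m (arr g q)) \<circ> k g) (free_gen (r, p))"
        using rp q by (simp add: \<alpha>_gen)
    qed
    then show ?thesis by simp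
  qed
  have k_N: "k g n = \<one>\<^bsub>Grp K (e g)\<^esub>" if g: "g \<in> carrier G" and n: "n \<in> N" for g n
  proof (rule N_trivial[OF gr[OF g] k_hom[OF g] _ n])
    fix a b assume ab: "a \<in> carrier H" "b \<in> carrier H"
    interpret kg: group_hom H "Grp K (e g)" "k g" by (rule k_group_hom[OF g])
    show "inv\<^bsub>Grp K (e g)\<^esub> k g a \<otimes>\<^bsub>Grp K (e g)\<^esub> k g b \<otimes>\<^bsub>Grp K (e g)\<^esub> k g a = k g (\<alpha> (\<theta> a) b)"
      using k_Act[OF g, of "\<theta> a" b] ab g by (simp add: K.Peiffer[OF e[OF g]] k_Bd \<phi>\<theta>)
  qed
  define f where "f g c = the_elem (k g ` c)" for g c
  have f: "f g (N #>\<^bsub>H\<^esub> w) = k g w" if "g \<in> carrier G" "w \<in> carrier H" for g w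
    unfolding f_def by (rule the_elem_coset[OF N_normal gr k_hom k_N]) (use that in auto)
  have f_gen: "f g (\<iota> r) = j g r" if "g \<in> carrier G" "r \<in> R" for g r
    using that by (simp add: free_xmod_gen_def f gen_closed k_gen arr_one K.Act_Ident e j)
  have f_hom: "f g \<in> hom (Grp C ()) (Grp K (e g))" if g: "g \<in> carrier G" for g
  proof -
    interpret kg: group_hom H "Grp K (e g)" "k g" by (rule k_group_hom[OF g])
    show ?thesis by (rule homI) (auto simp: C_carrier C_mult f g)
  qed
  show ?thesis
    by (intro exI[of _ f] conjI ballI)
      (auto simp: f_hom f_gen C_carrier C_Bd C_Act f k_Bd k_Act \<alpha>_closed)
qed

theorem free_crossed_module_C:
  "free_crossed_module TYPE('n) (one_object P) (\<lambda>_. R) (\<lambda>_. \<omega>) C (\<lambda>_. \<iota>)"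
  unfolding free_crossed_module_def
proof (intro conjI ballI allI impI)
  fix K :: "(unit, 'p, 'n) xmod" and j :: "unit \<Rightarrow> 'r \<Rightarrow> 'n"
  assume K: "crossed_module (one_object P) K"
    and j: "\<forall>x \<in> Obj (one_object P). \<forall>s \<in> R. j x s \<in> carrier (Grp K x) \<and> Bd K x (j x s) = \<omega> s"
  interpret K: crossed_module "one_object P" K by fact
  let ?T = "\<lparr>carrier = {()}, monoid.mult = (\<lambda>_ _. ()), one = ()\<rparr>"
  have T: "group ?T" by (rule groupI) auto
  obtain f where f: "f \<in> hom (Grp C ()) (Grp K ())"
      "\<And>c. c \<in> carrier (Grp C ()) \<Longrightarrow> Bd K () (f c) = Bd C () c"
      "\<And>c p. c \<in> carrier (Grp C ()) \<Longrightarrow> p \<in> carrier P \<Longrightarrow> f (Act C c p) = Act K (f c) p"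
      "\<And>r. r \<in> R \<Longrightarrow> f (\<iota> r) = j () r"
    using lift_exists[OF T _ _ K, of "\<lambda>_. ()" "\<lambda>_. ()" "\<lambda>_ p. p" j] j
    by (auto simp: hom_def)
  show "\<exists>f. xmod_morphism (one_object P) C K f \<and> (\<forall>x \<in> Obj (one_object P). \<forall>s \<in> R. f x (\<iota> s) = j x s) \<and>
      (\<forall>f'. xmod_morphism (one_object P) C K f' \<and> (\<forall>x \<in> Obj (one_object P). \<forall>s \<in> R. f' x (\<iota> s) = j x s) \<longrightarrow>
        (\<forall>x \<in> Obj (one_object P). \<forall>m \<in> carrier (Grp C x). f' x m = f x m))"
  proof (intro exI[of _ "\<lambda>_. f"] conjI allI impI ballI)
    show "xmod_morphism (one_object P) C K (\<lambda>_. f)"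
      using f by (simp add: xmod_morphism_def)
    fix f' x m
    assume f': "xmod_morphism (one_object P) C K f' \<and> (\<forall>x \<in> Obj (one_object P). \<forall>s \<in> R. f' x (\<iota> s) = j x s)"
      and m: "x \<in> Obj (one_object P)" "m \<in> carrier (Grp C x)"
    show "f' x m = f m"
    proof (rule C_hom_unique[OF K.Grp_group _ _ _ m(2)])
      show "f' x \<in> hom (Grp C x) (Grp K x)" using f' by (simp add: xmod_morphism_def)
      show "f \<in> hom (Grp C x) (Grp K x)" using f by simp
      fix r p assume "r \<in> R" "p \<in> carrier P"
      then show "f' x (Act C (\<iota> r) p) = f (Act C (\<iota> r) p)"
        using f f' \<iota>_closed[of r "()"] by (simp add: xmod_morphism_def)
    qed simp
  qed (use f in auto)
qed (simp_all add: crossed_module_C \<iota>_closed \<iota>_Bd)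

end


section \<open>The covering crossed module over the Cayley groupoid\<close>

definition cayley_xmod ::
  "('g, 'k) monoid_scheme \<Rightarrow> ('p \<Rightarrow> 'g) \<Rightarrow> (unit, 'p, 'c) xmod \<Rightarrow> ('g, 'g \<times> 'p, 'g \<times> 'c) xmod" where
  "cayley_xmod G \<phi> C = \<lparr>
     Grp = (\<lambda>g. \<lparr>carrier = {g} \<times> carrier (Grp C ()),
       monoid.mult = (\<lambda>(h, c) (_, c'). (h, c \<otimes>\<^bsub>Grp C ()\<^esub> c')), one = (g, \<one>\<^bsub>Grp C ()\<^esub>)\<rparr>),
     Bd = (\<lambda>_ (g, c). (g, Bd C () c)),
     Act = (\<lambda>(g, c) (_, u). (g \<otimes>\<^bsub>G\<^esub> \<phi> u, Act C c u))\<rparr>"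

lemma cayley_xmod_simps [simp]:
  "carrier (Grp (cayley_xmod G \<phi> C) g) = {g} \<times> carrier (Grp C ())"
  "(h, c) \<otimes>\<^bsub>Grp (cayley_xmod G \<phi> C) g\<^esub> (h', c') = (h, c \<otimes>\<^bsub>Grp C ()\<^esub> c')"
  "\<one>\<^bsub>Grp (cayley_xmod G \<phi> C) g\<^esub> = (g, \<one>\<^bsub>Grp C ()\<^esub>)"
  "Bd (cayley_xmod G \<phi> C) g (h, c) = (h, Bd C () c)"
  "Act (cayley_xmod G \<phi> C) (g, c) (h, u) = (g \<otimes>\<^bsub>G\<^esub> \<phi> u, Act C c u)"
  by (simp_all add: cayley_xmod_def)

lemma crossed_module_cayley:
  assumes G: "group G" and P: "group P" and \<phi>: "\<phi> \<in> hom P G"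
    and C: "crossed_module (one_object P) C"
    and trivial: "\<And>c. c \<in> carrier (Grp C ()) \<Longrightarrow> \<phi> (Bd C () c) = \<one>\<^bsub>G\<^esub>"
  shows "crossed_module (cayley_groupoid G P \<phi>) (cayley_xmod G \<phi> C)"
proof -
  interpret G: group G by fact
  interpret P: group P by fact
  interpret \<phi>: group_hom P G \<phi> by unfold_locales fact
  interpret C: crossed_module "one_object P" C by fact
  interpret D: group "Grp C ()" by (simp add: C.Grp_group)
  let ?C = "cayley_xmod G \<phi> C"
  have Bd: "Bd C () c \<in> carrier P" if "c \<in> carrier (Grp C ())" for c
    using C.Bd_closed[of "()" c] that by simp
  have gr: "group (Grp ?C g)" for g
    by (rule groupI) (auto simp: D.m_assoc intro: bexI[of _ "inv\<^bsub>Grp C ()\<^esub> _"] D.l_inv)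
  have inv: "inv\<^bsub>Grp ?C g\<^esub> (g, c) = (g, inv\<^bsub>Grp C ()\<^esub> c)" if "c \<in> carrier (Grp C ())" for g c
    by (rule group.inv_equality[OF gr]) (use that in auto)
  show ?thesis
  proof (intro crossed_module.intro crossed_module_axioms.intro, goal_cases)
    case 1
    show ?case by (rule groupoid_cayley[OF G P \<phi>])
  next
    case (9 u x y m)
    then show ?case
      using C.Bd_Act[of _ "()" "()"]
      by (auto simp: Inverse_cayley[OF G P \<phi>] Inverse_one_object[OF P])
  next
    case (5 u x y m)
    then show ?case using C.Act_closed[of _ "()" "()"] by auto
  next
    case (7 u x y v z m)
    then show ?case using C.Act_Comp[of _ "()" "()" _ "()"] by (auto simp: G.m_assoc)
  next
    case (8 u x y m n)
    then show ?case using C.Act_mult[of _ "()" "()"] by auto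
  next
    case (10 x m n)
    then show ?case using C.Peiffer[of "()"] by (auto simp: inv trivial)
  qed (use gr C.Act_Ident[of "()"] C.Bd_mult[of "()"] in \<open>auto simp: Bd trivial\<close>)
qed

theorem free_crossed_module_cayley:
  assumes G: "group G" and P: "group P" and \<phi>: "\<phi> \<in> hom P G"
    and \<omega>: "\<omega> \<in> R \<rightarrow> carrier P" "\<And>r. r \<in> R \<Longrightarrow> \<phi> (\<omega> r) = \<one>\<^bsub>G\<^esub>"
  shows "free_crossed_module TYPE('n) (cayley_groupoid G P \<phi>)
    (\<lambda>g. {g} \<times> R) (\<lambda>_ (g, r). (g, \<omega> r))
    (cayley_xmod G \<phi> (free_xmod P R \<omega>)) (\<lambda>_ (g, r). (g, free_xmod_gen P R \<omega> r))"
proof -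
  interpret G: group G by fact
  interpret P: group P by fact
  interpret \<phi>: group_hom P G \<phi> by unfold_locales fact
  interpret free_xmod_data P R \<omega> by unfold_locales (use \<omega>(1) in auto)
  interpret C: crossed_module "one_object P" C by (rule crossed_module_C)
  have C_Bd_closed: "Bd C () c \<in> carrier P" if "c \<in> carrier (Grp C ())" for c
    using C.Bd_closed[of "()" c] that by simp
  have C_Act_closed: "Act C c p \<in> carrier (Grp C ())" if "c \<in> carrier (Grp C ())" "p \<in> carrier P" for c p
    using C.Act_closed[of p "()" "()" c] that by simp
  let ?\<Phi> = "cayley_groupoid G P \<phi>" and ?C = "cayley_xmod G \<phi> C"
  have \<phi>\<theta>: "\<phi> (\<theta> w) = \<one>\<^bsub>G\<^esub>" if "w \<in> carrier H" for w
  proof -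
    have "(\<phi> \<circ> \<theta>) w = (\<lambda>_. \<one>\<^bsub>G\<^esub>) w"
      by (rule H_hom_unique[OF G.is_group hom_compose[OF \<theta>.homh \<phi>.homh] _ _ that])
        (auto intro: homI simp: \<theta>_gen \<omega>_closed \<omega>(2))
    then show ?thesis by simp
  qed
  show ?thesis
    unfolding free_crossed_module_def
  proof (intro conjI ballI allI impI)
    show "crossed_module ?\<Phi> ?C"
      by (rule crossed_module_cayley[OF G P \<phi> crossed_module_C]) (auto simp: C_carrier C_Bd \<phi>\<theta>)
  next
    fix K :: "('a, 'a \<times> 'c, 'n) xmod" and j :: "'a \<Rightarrow> 'a \<times> 'e \<Rightarrow> 'n"
    assume K: "crossed_module ?\<Phi> K"
      and j: "\<forall>x \<in> Obj ?\<Phi>. \<forall>s \<in> {x} \<times> R. j x s \<in> carrier (Grp K x) \<and> Bd K x (j x s) = (case s of (g, r) \<Rightarrow> (g, \<omega> r))"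
    interpret K: crossed_module ?\<Phi> K by fact
    obtain f where f: "\<And>g. g \<in> carrier G \<Longrightarrow> f g \<in> hom (Grp C ()) (Grp K g)"
        "\<And>g c. g \<in> carrier G \<Longrightarrow> c \<in> carrier (Grp C ()) \<Longrightarrow> Bd K g (f g c) = (g, Bd C () c)"
        "\<And>g c p. g \<in> carrier G \<Longrightarrow> c \<in> carrier (Grp C ()) \<Longrightarrow> p \<in> carrier P \<Longrightarrow>
          f (g \<otimes>\<^bsub>G\<^esub> \<phi> p) (Act C c p) = Act K (f g c) (g, p)"
        "\<And>g r. g \<in> carrier G \<Longrightarrow> r \<in> R \<Longrightarrow> f g (\<iota> r) = j g (g, r)"
    proof -
      have "\<exists>f. (\<forall>g \<in> carrier G. f g \<in> hom (Grp C ()) (Grp K g)) \<and>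
          (\<forall>g \<in> carrier G. \<forall>c \<in> carrier (Grp C ()). Bd K g (f g c) = (g, Bd C () c)) \<and>
          (\<forall>g \<in> carrier G. \<forall>c \<in> carrier (Grp C ()). \<forall>p \<in> carrier P.
             f (g \<otimes>\<^bsub>G\<^esub> \<phi> p) (Act C c p) = Act K (f g c) (g, p)) \<and>
          (\<forall>g \<in> carrier G. \<forall>r \<in> R. f g (\<iota> r) = j g (g, r))"
        by (rule lift_exists[OF G \<phi> \<omega>(2) K, of "\<lambda>g. g" Pair "\<lambda>g r. j g (g, r)"]) (use j in auto)
      then show thesis
        by (elim exE conjE, intro that) blast+
    qed
    show "\<exists>f. xmod_morphism ?\<Phi> ?C K f \<and>
        (\<forall>x \<in> Obj ?\<Phi>. \<forall>s \<in> {x} \<times> R. f x (case s of (g, r) \<Rightarrow> (g, \<iota> r)) = j x s) \<and>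
        (\<forall>f'. xmod_morphism ?\<Phi> ?C K f' \<and>
            (\<forall>x \<in> Obj ?\<Phi>. \<forall>s \<in> {x} \<times> R. f' x (case s of (g, r) \<Rightarrow> (g, \<iota> r)) = j x s) \<longrightarrow>
          (\<forall>x \<in> Obj ?\<Phi>. \<forall>m \<in> carrier (Grp ?C x). f' x m = f x m))"
    proof (intro exI[of _ "\<lambda>g m. f g (snd m)"] conjI allI impI ballI)
      show "xmod_morphism ?\<Phi> ?C K (\<lambda>g m. f g (snd m))"
        unfolding xmod_morphism_def
        using f by (auto simp: hom_def Pi_iff)
      fix f' x m
      assume f': "xmod_morphism ?\<Phi> ?C K f' \<and>
          (\<forall>x \<in> Obj ?\<Phi>. \<forall>s \<in> {x} \<times> R. f' x (case s of (g, r) \<Rightarrow> (g, \<iota> r)) = j x s)"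
        and m: "x \<in> Obj ?\<Phi>" "m \<in> carrier (Grp ?C x)"
      then have x: "x \<in> carrier G" by simp
      have "f' x (x, snd m) = f x (snd m)"
      proof (rule C_hom_unique[OF K.Grp_group[OF m(1)], of _ "()" _ "snd m"])
        have "f' x \<in> hom (Grp ?C x) (Grp K x)" using f' m by (simp add: xmod_morphism_def)
        then show "(\<lambda>c. f' x (x, c)) \<in> hom (Grp C ()) (Grp K x)"
          by (force simp: hom_def Pi_iff)
        show "f x \<in> hom (Grp C ()) (Grp K x)" using f x by simp
        show "snd m \<in> carrier (Grp C ())" using m by auto
        fix r p assume rp: "r \<in> R" "p \<in> carrier P"
        let ?g = "x \<otimes>\<^bsub>G\<^esub> inv\<^bsub>G\<^esub> \<phi> p"
        have g: "?g \<in> carrier G" "?g \<otimes>\<^bsub>G\<^esub> \<phi> p = x" using x rp by (auto simp: G.m_assoc)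
        have u: "(?g, p) \<in> Homset ?\<Phi> ?g x" using g rp by simp
        have "f' x (Act ?C (?g, \<iota> r) (?g, p)) = Act K (f' ?g (?g, \<iota> r)) (?g, p)"
        proof -
          have "\<forall>x y. \<forall>u \<in> Homset ?\<Phi> x y. \<forall>m \<in> carrier (Grp ?C x). f' y (Act ?C m u) = Act K (f' x m) u"
            using conjunct1[OF f'] unfolding xmod_morphism_def by (elim conjE)
          moreover have "(?g, \<iota> r) \<in> carrier (Grp ?C ?g)" using \<iota>_closed[OF rp(1), of "()"] by simp
          ultimately show ?thesis using u by blast
        qed
        also have "f' ?g (?g, \<iota> r) = j ?g (?g, r)" using f' g rp by auto
        also have "Act K (j ?g (?g, r)) (?g, p) = f x (Act C (\<iota> r) p)"
          using f(3)[OF g(1) \<iota>_closed[OF rp(1)] rp(2)] f(4)[OF g(1) rp(1)] g(2) by simp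
        finally show "f' x (x, Act C (\<iota> r) p) = f x (Act C (\<iota> r) p)" using g by simp
      qed
      then show "f' x m = f x (snd m)" using m by (cases m) auto
    qed (use f(4) in auto)
  qed (auto simp: \<iota>_closed \<iota>_Bd)
qed

text \<open>Prescribed values on the free generators determine a unique morphism to an abelian
  group that kills the operation.\<close>

lemma kills_operation_unique_extension:
  fixes A :: "'b monoid" and M :: "('o, 'a, 'm) xmod"
  assumes free: "free_crossed_module TYPE('b \<times> 'm) \<Phi> S w M \<iota>" and A: "comm_group A"
    and \<kappa>: "\<And>x s. x \<in> Obj \<Phi> \<Longrightarrow> s \<in> S x \<Longrightarrow> \<kappa> x s \<in> carrier A"
  shows "\<exists>k. kills_operation \<Phi> M A k \<and> (\<forall>x \<in> Obj \<Phi>. \<forall>s \<in> S x. k x (\<iota> x s) = \<kappa> x s) \<and>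
    (\<forall>k'. kills_operation \<Phi> M A k' \<and> (\<forall>x \<in> Obj \<Phi>. \<forall>s \<in> S x. k' x (\<iota> x s) = \<kappa> x s) \<longrightarrow>
       (\<forall>x \<in> Obj \<Phi>. \<forall>m \<in> carrier (Grp M x). k' x m = k x m))"
proof -
  interpret A: comm_group A by fact
  interpret M: crossed_module \<Phi> M using free by (simp add: free_crossed_module_def)
  define K :: "('o, 'a, 'b \<times> 'm) xmod" where
    "K = \<lparr>Grp = (\<lambda>x. A \<times>\<times> Grp M x), Bd = (\<lambda>x m. Bd M x (snd m)), Act = (\<lambda>m u. (fst m, Act M (snd m) u))\<rparr>"
  have obj: "x \<in> Obj \<Phi>" "y \<in> Obj \<Phi>" if "u \<in> Homset \<Phi> x y" for u x y
    using that M.Src_closed M.Tgt_closed by (auto simp: Homset_def)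
  have K: "crossed_module \<Phi> K"
  proof (intro crossed_module.intro crossed_module_axioms.intro, goal_cases)
    case 1
    show ?case by (rule M.groupoid_axioms)
  next
    case (2 x)
    then show ?case by (simp add: K_def DirProd_group A.is_group M.Grp_group)
  next
    case (10 x m n)
    then interpret Mx: group "Grp M x" by (simp add: M.Grp_group)
    from 10 show ?case
      by (auto simp: K_def inv_DirProd[OF A.is_group Mx.is_group] M.Peiffer A.m_comm A.m_lcomm)
  qed (auto simp: K_def M.Bd_closed M.Bd_mult M.Act_closed M.Act_Ident M.Act_Comp M.Act_mult M.Bd_Act)
  have ex: "\<exists>f. xmod_morphism \<Phi> M K f \<and> (\<forall>x \<in> Obj \<Phi>. \<forall>s \<in> S x. f x (\<iota> x s) = (\<kappa> x s, \<iota> x s)) \<and>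
      (\<forall>f'. xmod_morphism \<Phi> M K f' \<and> (\<forall>x \<in> Obj \<Phi>. \<forall>s \<in> S x. f' x (\<iota> x s) = (\<kappa> x s, \<iota> x s)) \<longrightarrow>
         (\<forall>x \<in> Obj \<Phi>. \<forall>m \<in> carrier (Grp M x). f' x m = f x m))"
  proof -
    have "\<forall>x \<in> Obj \<Phi>. \<forall>s \<in> S x. (\<kappa> x s, \<iota> x s) \<in> carrier (Grp K x) \<and> Bd K x (\<kappa> x s, \<iota> x s) = w x s"
      using free \<kappa> by (simp add: K_def free_crossed_module_def)
    then show ?thesis
      using free K unfolding free_crossed_module_def
      by (elim conjE allE[of _ K] allE[of _ "\<lambda>x s. (\<kappa> x s, \<iota> x s)"]) blast
  qed
  then obtain f where f: "xmod_morphism \<Phi> M K f" "\<forall>x \<in> Obj \<Phi>. \<forall>s \<in> S x. f x (\<iota> x s) = (\<kappa> x s, \<iota> x s)"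
    and uniq: "\<And>f' x m. xmod_morphism \<Phi> M K f' \<Longrightarrow> (\<forall>x \<in> Obj \<Phi>. \<forall>s \<in> S x. f' x (\<iota> x s) = (\<kappa> x s, \<iota> x s)) \<Longrightarrow>
      x \<in> Obj \<Phi> \<Longrightarrow> m \<in> carrier (Grp M x) \<Longrightarrow> f' x m = f x m"
    by blast
  show ?thesis
  proof (intro exI[of _ "\<lambda>x m. fst (f x m)"] conjI allI impI ballI)
    show "kills_operation \<Phi> M A (\<lambda>x m. fst (f x m))"
      unfolding kills_operation_def
    proof (intro conjI ballI allI)
      fix x assume x: "x \<in> Obj \<Phi>"
      then have "f x \<in> hom (Grp M x) (A \<times>\<times> Grp M x)" using f(1) by (simp add: xmod_morphism_def K_def)
      then show "(\<lambda>m. fst (f x m)) \<in> hom (Grp M x) A"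
        by (auto simp: hom_def Pi_iff mem_Times_iff mult_DirProd')
    next
      fix x y u m assume "u \<in> Homset \<Phi> x y" "m \<in> carrier (Grp M x)"
      then show "fst (f y (Act M m u)) = fst (f x m)"
        using f(1) by (simp add: xmod_morphism_def K_def)
    qed
    show "fst (f x (\<iota> x s)) = \<kappa> x s" if "x \<in> Obj \<Phi>" "s \<in> S x" for x s
      using f(2) that by simp
    fix k' x m
    assume k': "kills_operation \<Phi> M A k' \<and> (\<forall>x \<in> Obj \<Phi>. \<forall>s \<in> S x. k' x (\<iota> x s) = \<kappa> x s)"
      and x: "x \<in> Obj \<Phi>" "m \<in> carrier (Grp M x)"
    have "(k' x m, m) = f x m"
    proof (rule uniq[of "\<lambda>x m. (k' x m, m)", OF _ _ x])
      show "xmod_morphism \<Phi> M K (\<lambda>x m. (k' x m, m))"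
        using k' by (auto simp: xmod_morphism_def kills_operation_def K_def hom_def Pi_iff)
    qed (use k' in simp)
    then show "k' x m = fst (f x m)" by (metis fst_conv)
  qed
qed


section \<open>Right modules over a group\<close>

record ('a, 'g) gmodule = "'a monoid" +
  gact :: "'a \<Rightarrow> 'g \<Rightarrow> 'a"

locale right_gmodule = G: group G + comm_group A
  for G :: "('g, 'k) monoid_scheme" and A :: "('a, 'g, 'z) gmodule_scheme" +
  assumes gact_closed: "a \<in> carrier A \<Longrightarrow> g \<in> carrier G \<Longrightarrow> gact A a g \<in> carrier A"
    and gact_one: "a \<in> carrier A \<Longrightarrow> gact A a \<one>\<^bsub>G\<^esub> = a"
    and gact_gact: "a \<in> carrier A \<Longrightarrow> g \<in> carrier G \<Longrightarrow> h \<in> carrier G \<Longrightarrow>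
      gact A (gact A a g) h = gact A a (g \<otimes>\<^bsub>G\<^esub> h)"
    and gact_mult: "a \<in> carrier A \<Longrightarrow> b \<in> carrier A \<Longrightarrow> g \<in> carrier G \<Longrightarrow>
      gact A (a \<otimes>\<^bsub>A\<^esub> b) g = gact A a g \<otimes>\<^bsub>A\<^esub> gact A b g"

definition gmodule_hom ::
  "('g, 'k) monoid_scheme \<Rightarrow> ('a, 'g, 'y) gmodule_scheme \<Rightarrow> ('b, 'g, 'z) gmodule_scheme \<Rightarrow> ('a \<Rightarrow> 'b) set" where
  "gmodule_hom G A B =
     {f \<in> hom A B. \<forall>a \<in> carrier A. \<forall>g \<in> carrier G. f (gact A a g) = gact B (f a) g}"

definition submodule :: "('g, 'k) monoid_scheme \<Rightarrow> ('a, 'g, 'z) gmodule_scheme \<Rightarrow> 'a set \<Rightarrow> bool" where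
  "submodule G A N \<longleftrightarrow> subgroup N A \<and> (\<forall>a \<in> N. \<forall>g \<in> carrier G. gact A a g \<in> N)"

definition gmodule_span :: "('g, 'k) monoid_scheme \<Rightarrow> ('a, 'g, 'z) gmodule_scheme \<Rightarrow> 'a set \<Rightarrow> 'a set" where
  "gmodule_span G A S = \<Inter> {N. submodule G A N \<and> S \<subseteq> N}"

text \<open>The free module on \<open>I\<close> is written additively; its underlying abelian group is free
  on \<open>I \<times> G\<close>, where \<open>(i, g)\<close> stands for \<open>i \<cdot> g\<close>.\<close>

definition free_gmodule :: "('g, 'k) monoid_scheme \<Rightarrow> 'i set \<Rightarrow> ('i \<times> 'g \<Rightarrow>\<^sub>0 int, 'g) gmodule" where
  "free_gmodule G I =
     \<lparr>carrier = carrier (free_Abelian_group (I \<times> carrier G)), monoid.mult = (+), one = 0,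
      gact = (\<lambda>c g. frag_extend (\<lambda>(i, h). frag_of (i, h \<otimes>\<^bsub>G\<^esub> g)) c)\<rparr>"

definition free_gmodule_gen :: "('g, 'k) monoid_scheme \<Rightarrow> 'i \<Rightarrow> ('i \<times> 'g \<Rightarrow>\<^sub>0 int)" where
  "free_gmodule_gen G i = frag_of (i, \<one>\<^bsub>G\<^esub>)"

lemma right_gmodule_free_gmodule:
  assumes "group G" shows "right_gmodule G (free_gmodule G I)"
proof -
  interpret G: group G by fact
  let ?A = "free_gmodule G I"
  have cg: "comm_group ?A"
  proof (rule comm_groupI)
    show "\<exists>y \<in> carrier ?A. y \<otimes>\<^bsub>?A\<^esub> x = \<one>\<^bsub>?A\<^esub>" if "x \<in> carrier ?A" for x
      using that by (intro bexI[of _ "- x"]) (auto simp: free_gmodule_def)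
  qed (auto simp: free_gmodule_def algebra_simps dest: subsetD[OF keys_add])
  have keys: "Poly_Mapping.keys (gact ?A a g) \<subseteq> I \<times> carrier G"
    if "a \<in> carrier ?A" "g \<in> carrier G" for a g
    using that keys_frag_extend[of "\<lambda>(i, h). frag_of (i, h \<otimes>\<^bsub>G\<^esub> g)" a]
    by (fastforce simp: free_gmodule_def)
  show ?thesis
  proof (intro right_gmodule.intro right_gmodule_axioms.intro cg G.is_group)
    fix a g h assume a: "a \<in> carrier ?A"
    show "gact ?A a \<one>\<^bsub>G\<^esub> = a"
    proof -
      have "frag_extend (\<lambda>(i, h). frag_of (i, h \<otimes>\<^bsub>G\<^esub> \<one>\<^bsub>G\<^esub>)) a = frag_extend frag_of a"
        using a by (intro frag_extend_eq) (auto simp: free_gmodule_def)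
      then show ?thesis by (simp add: free_gmodule_def flip: frag_expansion)
    qed
    assume g: "g \<in> carrier G"
    show "gact ?A a g \<in> carrier ?A" using keys[OF a g] by (simp add: free_gmodule_def)
    show "gact ?A (a \<otimes>\<^bsub>?A\<^esub> b) g = gact ?A a g \<otimes>\<^bsub>?A\<^esub> gact ?A b g" for b
      by (simp add: free_gmodule_def frag_extend_add)
    assume h: "h \<in> carrier G"
    have "Poly_Mapping.keys a \<subseteq> I \<times> carrier G" using a by (simp add: free_gmodule_def)
    then show "gact ?A (gact ?A a g) h = gact ?A a (g \<otimes>\<^bsub>G\<^esub> h)"
      by (induction a rule: frag_induction)
        (auto simp: free_gmodule_def frag_extend_diff G.m_assoc g h)
  qed
qed

theorem free_gmodule_universal:
  assumes "right_gmodule G A" "f \<in> I \<rightarrow> carrier A"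
  shows "\<exists>h \<in> gmodule_hom G (free_gmodule G I) A. (\<forall>i \<in> I. h (free_gmodule_gen G i) = f i) \<and>
    (\<forall>h' \<in> gmodule_hom G (free_gmodule G I) A. (\<forall>i \<in> I. h' (free_gmodule_gen G i) = f i) \<longrightarrow>
       (\<forall>c \<in> carrier (free_gmodule G I). h' c = h c))"
proof -
  interpret A: right_gmodule G A by fact
  let ?F = "free_gmodule G I" and ?E = "free_Abelian_group (I \<times> carrier G)"
  interpret F: right_gmodule G ?F by (rule right_gmodule_free_gmodule[OF A.G.is_group])
  have hom_eq: "hom ?F A = hom ?E A" by (auto simp: hom_def free_gmodule_def)
  have uniq: "h c = h' c"
    if h: "h \<in> hom ?E A" "h' \<in> hom ?E A" and eq: "\<And>i g. i \<in> I \<Longrightarrow> g \<in> carrier G \<Longrightarrow> h (frag_of (i, g)) = h' (frag_of (i, g))"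
      and c: "c \<in> carrier ?E" for h h' c
  proof -
    interpret h: group_hom ?E A h
      by (simp add: group_hom_def group_hom_axioms_def A.is_group h)
    interpret h': group_hom ?E A h'
      by (simp add: group_hom_def group_hom_axioms_def A.is_group h)
    have diff: "x - y = x \<otimes>\<^bsub>?E\<^esub> inv\<^bsub>?E\<^esub> y" if "y \<in> carrier ?E" for x y
      using that by simp
    have "Poly_Mapping.keys c \<subseteq> I \<times> carrier G" using c by simp
    then show ?thesis
    proof (rule free_Abelian_group_induct[where P = "\<lambda>c. h c = h' c"])
      show "h 0 = h' 0" using h.hom_one h'.hom_one by simp
      fix x y
      assume "Poly_Mapping.keys x \<subseteq> I \<times> carrier G" "Poly_Mapping.keys y \<subseteq> I \<times> carrier G"
        and xy: "h x = h' x" "h y = h' y"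
      then have c: "x \<in> carrier ?E" "y \<in> carrier ?E" by simp_all
      note inv = group.inv_closed[OF group_free_Abelian_group c(2)]
      show "h (x - y) = h' (x - y)"
        unfolding diff[OF c(2)] h.hom_mult[OF c(1) inv] h'.hom_mult[OF c(1) inv]
          h.hom_inv[OF c(2)] h'.hom_inv[OF c(2)] xy ..
    qed (auto simp: eq)
  qed
  have fc: "f i \<in> carrier A" if "i \<in> I" for i using assms(2) that by auto
  then have "(\<lambda>(i, g). gact A (f i) g) ` (I \<times> carrier G) \<subseteq> carrier A"
    by (auto intro!: A.gact_closed)
  then obtain h where h: "h \<in> hom ?E A"
      "\<And>x. x \<in> I \<times> carrier G \<Longrightarrow> h (frag_of x) = (case x of (i, g) \<Rightarrow> gact A (f i) g)"
    using A.free_Abelian_group_universal[of "\<lambda>(i, g). gact A (f i) g" "I \<times> carrier G"] by blast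
  have gact_hom: "(\<lambda>a. gact A a g) \<in> hom A A" "gact ?F c g \<in> carrier ?F"
    "(\<lambda>c. gact ?F c g) \<in> hom ?E ?E" if "g \<in> carrier G" "c \<in> carrier ?F" for g c
  proof -
    show "(\<lambda>a. gact A a g) \<in> hom A A" using that by (auto intro!: homI A.gact_closed A.gact_mult)
    show "gact ?F c g \<in> carrier ?F" using that by (rule F.gact_closed[rotated])
    have "(\<lambda>c. gact ?F c g) \<in> hom ?F ?F" using that by (auto intro!: homI F.gact_closed F.gact_mult)
    then show "(\<lambda>c. gact ?F c g) \<in> hom ?E ?E" by (simp add: hom_def free_gmodule_def)
  qed
  have gact_gen: "gact ?F (frag_of (i, p)) g = frag_of (i, p \<otimes>\<^bsub>G\<^esub> g)" for i p g
    by (simp add: free_gmodule_def)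
  have gm: "h \<in> gmodule_hom G ?F A"
    unfolding gmodule_hom_def hom_eq
  proof (intro CollectI conjI ballI)
    fix c g assume c: "c \<in> carrier ?F" and g: "g \<in> carrier G"
    have "(h \<circ> (\<lambda>c. gact ?F c g)) c = ((\<lambda>a. gact A a g) \<circ> h) c"
    proof (rule uniq[OF hom_compose[OF gact_hom(3)[OF g c] h(1)] hom_compose[OF h(1) gact_hom(1)[OF g c]]])
      show "c \<in> carrier ?E" using c by (simp add: free_gmodule_def)
      fix i p assume "i \<in> I" "p \<in> carrier G"
      then show "(h \<circ> (\<lambda>c. gact ?F c g)) (frag_of (i, p)) = ((\<lambda>a. gact A a g) \<circ> h) (frag_of (i, p))"
        using g by (simp add: gact_gen h(2) fc A.gact_gact)
    qed
    then show "h (gact ?F c g) = gact A (h c) g" by simp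
  qed (rule h(1))
  show ?thesis
  proof (intro bexI[OF _ gm] conjI ballI impI)
    fix i assume "i \<in> I"
    then show "h (free_gmodule_gen G i) = f i"
      by (simp add: free_gmodule_gen_def h(2) fc A.gact_one)
  next
    fix h' c
    assume h': "h' \<in> gmodule_hom G ?F A" "\<forall>i \<in> I. h' (free_gmodule_gen G i) = f i"
      and c: "c \<in> carrier ?F"
    show "h' c = h c"
    proof (rule uniq[OF _ h(1)])
      show "h' \<in> hom ?E A" using h'(1) hom_eq by (auto simp: gmodule_hom_def)
      show "c \<in> carrier ?E" using c by (simp add: free_gmodule_def)
      fix i g assume ig: "i \<in> I" "g \<in> carrier G"
      then have "free_gmodule_gen G i \<in> carrier ?F"
        by (simp add: free_gmodule_gen_def free_gmodule_def)
      then have "h' (gact ?F (free_gmodule_gen G i) g) = gact A (f i) g"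
        using h' ig by (simp add: gmodule_hom_def)
      then show "h' (frag_of (i, g)) = h (frag_of (i, g))"
        using ig by (simp add: free_gmodule_gen_def gact_gen h(2))
    qed
  qed
qed


section \<open>The module of identities\<close>

text \<open>The kernel of a crossed module \<open>C \<rightarrow> P\<close> over a group, with the action of
  \<open>G = \<phi>(P)\<close> given by \<open>c \<cdot> \<phi> u = c\<^sup>u\<close>.\<close>

definition identity_module ::
  "('p, 'k) monoid_scheme \<Rightarrow> ('p \<Rightarrow> 'g) \<Rightarrow> (unit, 'p, 'c) xmod \<Rightarrow> ('c, 'g) gmodule" where
  "identity_module P \<phi> C =
     \<lparr>carrier = {c \<in> carrier (Grp C ()). Bd C () c = \<one>\<^bsub>P\<^esub>},
      monoid.mult = monoid.mult (Grp C ()), one = \<one>\<^bsub>Grp C ()\<^esub>,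
      gact = (\<lambda>c g. Act C c (inv_into (carrier P) \<phi> g))\<rparr>"

lemma identity_module_gact:
  assumes P: "group P" and G: "group G" and \<phi>: "\<phi> \<in> hom P G"
    and C: "crossed_module (one_object P) C"
    and kernel: "kernel P G \<phi> \<subseteq> Bd C () ` carrier (Grp C ())"
    and c: "c \<in> carrier (identity_module P \<phi> C)" and u: "u \<in> carrier P"
  shows "gact (identity_module P \<phi> C) c (\<phi> u) = Act C c u"
proof -
  interpret P: group P by fact
  interpret \<phi>: group_hom P G \<phi> by (simp add: group_hom_def group_hom_axioms_def assms)
  interpret C: crossed_module "one_object P" C by fact
  interpret D: group "Grp C ()" by (simp add: C.Grp_group)
  define v where "v = inv_into (carrier P) \<phi> (\<phi> u)"
  have v: "v \<in> carrier P" "\<phi> v = \<phi> u"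
    using u by (auto simp: v_def inv_into_into f_inv_into_f)
  have c': "c \<in> carrier (Grp C ())" "Bd C () c = \<one>\<^bsub>P\<^esub>" using c by (auto simp: identity_module_def)
  have "v \<otimes>\<^bsub>P\<^esub> inv\<^bsub>P\<^esub> u \<in> kernel P G \<phi>" using u v by (simp add: kernel_def)
  then obtain d where d: "d \<in> carrier (Grp C ())" "Bd C () d = v \<otimes>\<^bsub>P\<^esub> inv\<^bsub>P\<^esub> u" using kernel by auto
  have "c \<otimes>\<^bsub>Grp C ()\<^esub> d \<otimes>\<^bsub>Grp C ()\<^esub> inv\<^bsub>Grp C ()\<^esub> c = Act C d (inv\<^bsub>P\<^esub> (Bd C () c))"
    using C.Peiffer[of "()" d "inv\<^bsub>Grp C ()\<^esub> c"] c' d C.Bd_inv[of "()" c]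
    by (simp add: Inverse_one_object[OF P])
  also have "\<dots> = d" using c' d C.Act_Ident[of "()" d] by simp
  finally have "c \<otimes>\<^bsub>Grp C ()\<^esub> d = d \<otimes>\<^bsub>Grp C ()\<^esub> c"
    using c' d by (metis D.inv_closed D.inv_solve_right D.m_closed)
  then have "inv\<^bsub>Grp C ()\<^esub> d \<otimes>\<^bsub>Grp C ()\<^esub> c \<otimes>\<^bsub>Grp C ()\<^esub> d = c"
    using c' d by (simp add: D.m_assoc) (simp flip: D.m_assoc)
  then have "Act C c (v \<otimes>\<^bsub>P\<^esub> inv\<^bsub>P\<^esub> u) = c" using C.Peiffer[of "()" c d] c' d by simp
  then have "Act C c u = Act C c (v \<otimes>\<^bsub>P\<^esub> inv\<^bsub>P\<^esub> u \<otimes>\<^bsub>P\<^esub> u)"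
    using C.Act_Comp[of "v \<otimes>\<^bsub>P\<^esub> inv\<^bsub>P\<^esub> u" "()" "()" u "()" c] c' u v by simp
  also have "\<dots> = Act C c v" using u v by (simp add: P.m_assoc)
  finally show ?thesis by (simp add: identity_module_def v_def)
qed

lemma right_gmodule_identity_module:
  assumes P: "group P" and G: "group G" and \<phi>: "\<phi> \<in> epi P G"
    and C: "crossed_module (one_object P) C"
    and kernel: "kernel P G \<phi> \<subseteq> Bd C () ` carrier (Grp C ())"
  shows "right_gmodule G (identity_module P \<phi> C)"
proof -
  interpret P: group P by fact
  interpret G: group G by fact
  interpret \<phi>: group_hom P G \<phi> using \<phi> by (simp add: group_hom_def group_hom_axioms_def assms epi_def)
  interpret C: crossed_module "one_object P" C by fact
  interpret D: group "Grp C ()" by (simp add: C.Grp_group)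
  let ?\<pi> = "identity_module P \<phi> C"
  have Bd_mult: "Bd C () (c \<otimes>\<^bsub>Grp C ()\<^esub> d) = Bd C () c \<otimes>\<^bsub>P\<^esub> Bd C () d"
    if "c \<in> carrier (Grp C ())" "d \<in> carrier (Grp C ())" for c d
    using C.Bd_mult[of "()" c d] that by simp
  have Bd_one: "Bd C () \<one>\<^bsub>Grp C ()\<^esub> = \<one>\<^bsub>P\<^esub>" using C.Bd_one[of "()"] by simp
  have Bd_inv: "Bd C () (inv\<^bsub>Grp C ()\<^esub> c) = \<one>\<^bsub>P\<^esub>" if "c \<in> carrier ?\<pi>" for c
    using C.Bd_inv[of "()" c] that by (simp add: identity_module_def Inverse_one_object[OF P])
  have comm: "c \<otimes>\<^bsub>Grp C ()\<^esub> d = d \<otimes>\<^bsub>Grp C ()\<^esub> c" if "c \<in> carrier ?\<pi>" "d \<in> carrier ?\<pi>" for c d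
  proof -
    have cd: "c \<in> carrier (Grp C ())" "d \<in> carrier (Grp C ())" "Bd C () d = \<one>\<^bsub>P\<^esub>"
      using that by (auto simp: identity_module_def)
    have "inv\<^bsub>Grp C ()\<^esub> d \<otimes>\<^bsub>Grp C ()\<^esub> c \<otimes>\<^bsub>Grp C ()\<^esub> d = c"
      using C.Peiffer[of "()" c d] C.Act_Ident[of "()" c] cd by simp
    then show ?thesis using cd by (metis D.inv_closed D.inv_solve_left D.m_assoc D.m_closed)
  qed
  have cg: "comm_group ?\<pi>"
  proof (rule comm_groupI)
    show "\<exists>y \<in> carrier ?\<pi>. y \<otimes>\<^bsub>?\<pi>\<^esub> x = \<one>\<^bsub>?\<pi>\<^esub>" if "x \<in> carrier ?\<pi>" for x
      using that Bd_inv[OF that] by (intro bexI[of _ "inv\<^bsub>Grp C ()\<^esub> x"]) (auto simp: identity_module_def)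
    show "x \<otimes>\<^bsub>?\<pi>\<^esub> y = y \<otimes>\<^bsub>?\<pi>\<^esub> x" if "x \<in> carrier ?\<pi>" "y \<in> carrier ?\<pi>" for x y
      using comm[OF that] by (simp add: identity_module_def)
  qed (auto simp: identity_module_def Bd_mult Bd_one D.m_assoc)
  have lift: "\<exists>u \<in> carrier P. g = \<phi> u" if "g \<in> carrier G" for g
    using \<phi> that by (auto simp: epi_def)
  have gact: "gact ?\<pi> c (\<phi> u) = Act C c u" if "c \<in> carrier ?\<pi>" "u \<in> carrier P" for c u
    by (rule identity_module_gact[OF P G \<phi>.homh C kernel that])
  have closed: "Act C c u \<in> carrier ?\<pi>" if "c \<in> carrier ?\<pi>" "u \<in> carrier P" for c u
    using that C.Act_closed[of u "()" "()" c] C.Bd_Act[of u "()" "()" c]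
    by (simp add: identity_module_def Inverse_one_object[OF P])
  have C_carrier: "c \<in> carrier (Grp C ())" if "c \<in> carrier ?\<pi>" for c
    using that by (simp add: identity_module_def)
  show ?thesis
  proof (intro right_gmodule.intro right_gmodule_axioms.intro cg G)
    fix a g assume a: "a \<in> carrier ?\<pi>"
    show "gact ?\<pi> a \<one>\<^bsub>G\<^esub> = a"
      using gact[OF a P.one_closed] C.Act_Ident[of "()" a] a C_carrier by simp
    assume "g \<in> carrier G"
    then obtain u where u: "u \<in> carrier P" "g = \<phi> u" using lift by blast
    show "gact ?\<pi> a g \<in> carrier ?\<pi>" using a u by (simp add: gact closed)
    show "gact ?\<pi> (a \<otimes>\<^bsub>?\<pi>\<^esub> b) g = gact ?\<pi> a g \<otimes>\<^bsub>?\<pi>\<^esub> gact ?\<pi> b g" if b: "b \<in> carrier ?\<pi>" for b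
    proof -
      have "a \<otimes>\<^bsub>?\<pi>\<^esub> b \<in> carrier ?\<pi>" using cg a b by (simp add: comm_group_def group.is_monoid monoid.m_closed)
      then have "gact ?\<pi> (a \<otimes>\<^bsub>?\<pi>\<^esub> b) g = Act C (a \<otimes>\<^bsub>?\<pi>\<^esub> b) u" using u by (simp add: gact)
      also have "\<dots> = Act C a u \<otimes>\<^bsub>Grp C ()\<^esub> Act C b u"
        using C.Act_mult[of u "()" "()" a b] u C_carrier[OF a] C_carrier[OF b]
        by (simp add: identity_module_def)
      finally show ?thesis using a b u by (simp add: gact) (simp add: identity_module_def)
    qed
    fix h assume "h \<in> carrier G"
    then obtain v where v: "v \<in> carrier P" "h = \<phi> v" using lift by blast
    have "gact ?\<pi> (gact ?\<pi> a g) h = Act C a (u \<otimes>\<^bsub>P\<^esub> v)"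
      using C.Act_Comp[of u "()" "()" v "()" a] a u v C_carrier by (simp add: gact closed)
    then show "gact ?\<pi> (gact ?\<pi> a g) h = gact ?\<pi> a (g \<otimes>\<^bsub>G\<^esub> h)"
      using gact[OF a, of "u \<otimes>\<^bsub>P\<^esub> v"] u v by simp
  qed
qed

lemma right_gmodule_presentation:
  assumes pres: "presentation G X R \<omega> \<phi>"
  defines "F \<equiv> free_group X"
  shows "right_gmodule G (identity_module F \<phi> (free_xmod F R \<omega>))"
proof -
  have F: "group F" by (simp add: F_def group_free_group)
  have \<phi>: "\<phi> \<in> epi F G" and G: "group G" using pres by (simp_all add: presentation_def F_def)
  interpret free_xmod_data F R \<omega>
    by (intro free_xmod_data.intro free_xmod_data_axioms.intro F)
      (use pres in \<open>auto simp: presentation_def F_def\<close>)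
  have img: "\<theta> ` carrier H \<lhd> F"
    unfolding P.normal_inv_iff
  proof (intro conjI ballI)
    show "subgroup (\<theta> ` carrier H) F" by (rule \<theta>.img_is_subgroup)
    fix u x assume u: "u \<in> carrier F" and "x \<in> \<theta> ` carrier H"
    then obtain w where w: "w \<in> carrier H" "x = \<theta> w" by blast
    then have "u \<otimes>\<^bsub>F\<^esub> x \<otimes>\<^bsub>F\<^esub> inv\<^bsub>F\<^esub> u = \<theta> (\<alpha> (inv\<^bsub>F\<^esub> u) w)" using u by (simp add: \<theta>_\<alpha>)
    then show "u \<otimes>\<^bsub>F\<^esub> x \<otimes>\<^bsub>F\<^esub> inv\<^bsub>F\<^esub> u \<in> \<theta> ` carrier H" using u w by (simp add: \<alpha>_closed)
  qed
  have "\<omega> ` R \<subseteq> \<theta> ` carrier H"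
  proof
    fix x assume "x \<in> \<omega> ` R"
    then obtain r where r: "r \<in> R" "x = \<omega> r" by blast
    then have "x = \<theta> (free_gen (r, \<one>\<^bsub>F\<^esub>))" by (simp add: \<theta>_gen \<omega>_closed)
    then show "x \<in> \<theta> ` carrier H" using r by (simp add: gen_closed)
  qed
  then have "kernel F G \<phi> \<subseteq> \<theta> ` carrier H"
    using normal_closure_minimal[OF img] pres by (simp add: presentation_def F_def)
  also have "\<dots> \<subseteq> Bd C () ` carrier (Grp C ())" by (force simp: C_carrier C_Bd)
  finally show ?thesis by (rule right_gmodule_identity_module[OF F G \<phi> crossed_module_C])
qed

end

theory Submission
  imports Defs
begin

text \<open>For a family \<open>k1\<close> as in the theorem put \<open>h g c = k1(g, \<delta>2 c)\<^sup>-\<^sup>1 c\<^bsup>\<sigma>(g)\<^sup>-\<^sup>1\<^esup>\<close>. As a map of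
  \<open>(g, c)\<close> it takes central values, so it is a family of homomorphisms, and it kills the operation
  of the Cayley groupoid. Since it agrees with \<open>\<delta>3 k2\<close> on generators, \<open>\<delta>3 k2 = h\<close>; on identities
  \<open>c\<close> this reads \<open>\<delta>3 k2(g, c) = c \<cdot> g\<^sup>-\<^sup>1\<close>, so every \<open>\<delta>4[g, \<gamma>]\<close> is a relation. Conversely, modulo
  the elements \<open>\<delta>4[g, \<gamma>]\<close> we have \<open>\<gamma> \<cdot> g = k2(g\<^sup>-\<^sup>1, \<delta>3 \<gamma>) = k2(1, \<delta>3(\<gamma> \<cdot> g))\<close>, hence \<open>x = k2(1, \<delta>3 x)\<close>
  for all \<open>x\<close>, which vanishes if \<open>\<delta>3 x = 0\<close>.\<close>

section \<open>Modules\<close>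

lemma (in right_gmodule) gact_unit:
  assumes "g \<in> carrier G" shows "gact A \<one>\<^bsub>A\<^esub> g = \<one>\<^bsub>A\<^esub>"
proof -
  have "gact A \<one>\<^bsub>A\<^esub> g \<otimes>\<^bsub>A\<^esub> gact A \<one>\<^bsub>A\<^esub> g = gact A \<one>\<^bsub>A\<^esub> g"
    using gact_mult[of "\<one>\<^bsub>A\<^esub>" "\<one>\<^bsub>A\<^esub>" g] assms by simp
  then show ?thesis using gact_closed[of "\<one>\<^bsub>A\<^esub>" g] assms by simp
qed

lemma submodule_kernel:
  assumes A: "right_gmodule G A" and B: "right_gmodule G B" and f: "f \<in> gmodule_hom G A B"
  shows "submodule G A (kernel A B f)"
proof -
  interpret A: right_gmodule G A by fact
  interpret B: right_gmodule G B by fact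
  interpret f: group_hom A B f
    using f by unfold_locales (simp add: gmodule_hom_def)
  show ?thesis
    unfolding submodule_def using f.subgroup_kernel f
    by (auto simp: kernel_def gmodule_hom_def A.gact_closed B.gact_unit)
qed

lemma submodule_span:
  assumes A: "right_gmodule G A" and S: "S \<subseteq> carrier A"
  shows "submodule G A (gmodule_span G A S)"
proof -
  interpret A: right_gmodule G A by fact
  \<comment> \<open>The whole module belongs to the intersected family, which is therefore nonempty,
    as \<open>subgroups_Inter\<close> requires.\<close>
  have c: "carrier A \<in> {N. submodule G A N \<and> S \<subseteq> N}"
    using S by (simp add: submodule_def A.subgroup_self A.gact_closed)
  have "subgroup (gmodule_span G A S) A"
    unfolding gmodule_span_def using c
    by (intro A.subgroups_Inter) (auto simp: submodule_def)
  then show ?thesis by (auto simp: submodule_def gmodule_span_def)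
qed

lemma span_superset: "S \<subseteq> gmodule_span G A S"
  by (auto simp: gmodule_span_def)

lemma span_minimal: "submodule G A N \<Longrightarrow> S \<subseteq> N \<Longrightarrow> gmodule_span G A S \<subseteq> N"
  by (auto simp: gmodule_span_def)

section \<open>Additive form of the free modules\<close>

lemma free_gmodule_simps [simp]:
  "x \<in> carrier (free_gmodule G I) \<longleftrightarrow> Poly_Mapping.keys x \<subseteq> I \<times> carrier G"
  "x \<otimes>\<^bsub>free_gmodule G I\<^esub> y = x + y"
  "\<one>\<^bsub>free_gmodule G I\<^esub> = 0"
  "gact (free_gmodule G I) (frag_of (i, h)) g = frag_of (i, h \<otimes>\<^bsub>G\<^esub> g)"
  by (simp_all add: free_gmodule_def)

lemma inv_free_gmodule:
  assumes "group G" "x \<in> carrier (free_gmodule G I)"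
  shows "inv\<^bsub>free_gmodule G I\<^esub> x = - x"
proof -
  interpret right_gmodule G "free_gmodule G I" by (rule right_gmodule_free_gmodule[OF assms(1)])
  show ?thesis by (rule inv_equality) (use assms(2) in auto)
qed

text \<open>The free module on \<open>J\<close> consists of the elements of the free module on
  \<open>I\<close> supported on \<open>J\<close> times \<open>G\<close>, with the same operations.
  Hence \<delta>3 restricts to it as the same function.\<close>

lemma gmodule_hom_free_mono:
  assumes "J \<subseteq> I" shows "gmodule_hom G (free_gmodule G I) A \<subseteq> gmodule_hom G (free_gmodule G J) A"
proof -
  have "carrier (free_gmodule G J) \<subseteq> carrier (free_gmodule G I)"
    using order_trans[OF _ Sigma_mono[OF assms order_refl[of "carrier G"]]] by auto
  moreover have "gact (free_gmodule G J) = gact (free_gmodule G I)" by (simp add: free_gmodule_def)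
  ultimately show ?thesis
    by (simp add: gmodule_hom_def hom_def subset_iff Pi_iff del: free_gmodule_simps(1))
qed

section \<open>The crossed module of a presentation\<close>

locale group_presentation =
  fixes G :: "('g, 'k) monoid_scheme" and X :: "'x set" and R :: "'r set"
    and \<omega> :: "'r \<Rightarrow> 'x word" and \<phi> :: "'x word \<Rightarrow> 'g"
  assumes pres: "presentation G X R \<omega> \<phi>"
begin

abbreviation "F \<equiv> free_group X"

sublocale G: group G
  using pres by (simp add: presentation_def)

sublocale free_xmod_data F R \<omega>
  by (intro free_xmod_data.intro free_xmod_data_axioms.intro group_free_group)
    (use pres in \<open>auto simp: presentation_def\<close>)

sublocale \<phi>: group_hom F G \<phi>
  using pres by unfold_locales (simp add: presentation_def epi_def)

sublocale C: crossed_module "one_object F" C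
  by (rule crossed_module_C)

abbreviation "D \<equiv> Grp C ()"
abbreviation "\<delta> \<equiv> Bd C ()"
abbreviation "\<pi> \<equiv> identity_module F \<phi> C"

sublocale D: group D
  by (simp add: C.Grp_group)

sublocale \<delta>: group_hom D F \<delta>
  by unfold_locales (use C.Bd_closed[of "()"] C.Bd_mult[of "()"] in \<open>auto intro: homI\<close>)

sublocale \<pi>: right_gmodule G \<pi>
  by (rule right_gmodule_presentation[OF pres])

lemma \<phi>_surj: "g \<in> carrier G \<Longrightarrow> \<exists>u \<in> carrier F. \<phi> u = g"
  using pres unfolding presentation_def epi_def by (metis (mono_tags, lifting) imageE mem_Collect_eq)

lemma \<phi>_\<omega>: "r \<in> R \<Longrightarrow> \<phi> (\<omega> r) = \<one>\<^bsub>G\<^esub>"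
  using pres normal_closure_superset[of "\<omega> ` R" F] by (auto simp: presentation_def kernel_def)

lemma Act_closed [simp]: "c \<in> carrier D \<Longrightarrow> u \<in> carrier F \<Longrightarrow> Act C c u \<in> carrier D"
  using C.Act_closed[of u "()" "()" c] by simp

lemma Act_mult:
  "c \<in> carrier D \<Longrightarrow> d \<in> carrier D \<Longrightarrow> u \<in> carrier F \<Longrightarrow>
    Act C (c \<otimes>\<^bsub>D\<^esub> d) u = Act C c u \<otimes>\<^bsub>D\<^esub> Act C d u"
  using C.Act_mult[of u "()" "()" c d] by simp

lemma Act_Act:
  "c \<in> carrier D \<Longrightarrow> u \<in> carrier F \<Longrightarrow> v \<in> carrier F \<Longrightarrow> Act C (Act C c u) v = Act C c (u \<otimes>\<^bsub>F\<^esub> v)"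
  using C.Act_Comp[of u "()" "()" v "()" c] by simp

lemma Act_inv:
  assumes "c \<in> carrier D" "u \<in> carrier F" shows "Act C (inv\<^bsub>D\<^esub> c) u = inv\<^bsub>D\<^esub> (Act C c u)"
proof -
  interpret group_hom D D "\<lambda>c. Act C c u"
    using assms by unfold_locales (auto intro: homI simp: Act_mult)
  show ?thesis using assms by simp
qed

lemma \<delta>_Act:
  "c \<in> carrier D \<Longrightarrow> u \<in> carrier F \<Longrightarrow> \<delta> (Act C c u) = inv\<^bsub>F\<^esub> u \<otimes>\<^bsub>F\<^esub> \<delta> c \<otimes>\<^bsub>F\<^esub> u"
  using C.Bd_Act[of u "()" "()" c] by (simp add: Inverse_one_object group_free_group)

lemma Peiffer:
  "c \<in> carrier D \<Longrightarrow> d \<in> carrier D \<Longrightarrow> inv\<^bsub>D\<^esub> d \<otimes>\<^bsub>D\<^esub> c \<otimes>\<^bsub>D\<^esub> d = Act C c (\<delta> d)"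
  using C.Peiffer[of "()" c d] by simp

text \<open>\<open>C\<close> is generated by the translates of the \<open>\<iota> r\<close>, whose
  boundaries are conjugates of \<open>\<omega> r\<close> and so die in \<open>G\<close>.
  Consequently \<open>(g, \<delta> c)\<close> is a loop at \<open>g\<close>.\<close>

lemma \<phi>_\<delta>:
  assumes "c \<in> carrier D" shows "\<phi> (\<delta> c) = \<one>\<^bsub>G\<^esub>"
proof -
  have "(\<phi> \<circ> \<delta>) c = (\<lambda>_. \<one>\<^bsub>G\<^esub>) c"
    by (rule C_hom_unique[OF G.is_group hom_compose[OF \<delta>.homh \<phi>.homh] _ _ assms])
      (auto intro: homI simp: \<delta>_Act \<iota>_closed \<iota>_Bd \<omega>_closed \<phi>_\<omega>)
  then show ?thesis by simp
qed

text \<open>The image of \<delta> is normal because conjugating a boundary amounts to acting on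
  \<open>c\<close>; it contains the relators, hence their normal closure.\<close>

lemma kernel_\<phi>: "kernel F G \<phi> \<subseteq> \<delta> ` carrier D"
proof -
  have "\<delta> ` carrier D \<lhd> F"
    unfolding P.normal_inv_iff
  proof (intro conjI ballI)
    show "subgroup (\<delta> ` carrier D) F" by (rule \<delta>.img_is_subgroup)
    fix u x assume u: "u \<in> carrier F" and "x \<in> \<delta> ` carrier D"
    then obtain c where c: "c \<in> carrier D" "x = \<delta> c" by blast
    then have "u \<otimes>\<^bsub>F\<^esub> x \<otimes>\<^bsub>F\<^esub> inv\<^bsub>F\<^esub> u = \<delta> (Act C c (inv\<^bsub>F\<^esub> u))" using u by (simp add: \<delta>_Act)
    then show "u \<otimes>\<^bsub>F\<^esub> x \<otimes>\<^bsub>F\<^esub> inv\<^bsub>F\<^esub> u \<in> \<delta> ` carrier D" using u c by simp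
  qed
  moreover have "\<omega> ` R \<subseteq> \<delta> ` carrier D"
    using \<iota>_Bd[of _ "()"] \<iota>_closed[of _ "()"] by (force simp: image_iff)
  ultimately show ?thesis
    using normal_closure_minimal pres by (simp add: presentation_def)
qed

lemma \<pi>_carrier: "c \<in> carrier \<pi> \<longleftrightarrow> c \<in> carrier D \<and> \<delta> c = \<one>\<^bsub>F\<^esub>"
  by (simp add: identity_module_def)

lemma \<pi>_mult: "c \<otimes>\<^bsub>\<pi>\<^esub> d = c \<otimes>\<^bsub>D\<^esub> d" and \<pi>_one: "\<one>\<^bsub>\<pi>\<^esub> = \<one>\<^bsub>D\<^esub>"
  by (simp_all add: identity_module_def)

text \<open>The action is defined through one preimage picked by \<open>inv_into\<close>; this
  allows any preimage \<open>u\<close> in its place.\<close>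

lemma \<pi>_gact: "c \<in> carrier \<pi> \<Longrightarrow> u \<in> carrier F \<Longrightarrow> gact \<pi> c (\<phi> u) = Act C c u"
  by (rule identity_module_gact[OF P.is_group G.is_group \<phi>.homh crossed_module_C kernel_\<phi>])

text \<open>By the Peiffer rule, conjugation by \<open>z\<close> is the action of
  \<open>\<delta> z\<close>, which is the identity of \<open>F\<close>.\<close>

lemma \<pi>_central:
  assumes "c \<in> carrier D" "z \<in> carrier \<pi>" shows "c \<otimes>\<^bsub>D\<^esub> z = z \<otimes>\<^bsub>D\<^esub> c"
proof -
  have z: "z \<in> carrier D" "\<delta> z = \<one>\<^bsub>F\<^esub>" using assms(2) by (simp_all add: \<pi>_carrier)
  have "inv\<^bsub>D\<^esub> z \<otimes>\<^bsub>D\<^esub> c \<otimes>\<^bsub>D\<^esub> z = c"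
    using Peiffer[OF assms(1) z(1)] C.Act_Ident[of "()" c] assms(1) z by simp
  then show ?thesis using assms(1) z(1) by (metis D.inv_closed D.inv_solve_left D.m_assoc D.m_closed)
qed

end

section \<open>Contractions of the Cayley groupoid\<close>

locale cayley_contraction = group_presentation G X R \<omega> \<phi>
  for G :: "('g, 'k) monoid_scheme" and X :: "'x set" and R :: "'r set"
    and \<omega> :: "'r \<Rightarrow> 'x word" and \<phi> :: "'x word \<Rightarrow> 'g" +
  fixes \<sigma> :: "'g \<Rightarrow> 'x word" and k1 :: "'g \<times> 'x word \<Rightarrow> ('r \<times> 'x word) word set"
  assumes \<sigma>: "g \<in> carrier G \<Longrightarrow> \<sigma> g \<in> carrier F \<and> \<phi> (\<sigma> g) = g"
    and k1: "groupoid_morphism (cayley_groupoid G F \<phi>) (one_object D) (\<lambda>_. ()) k1"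
    and k1_gen: "g \<in> carrier G \<Longrightarrow> x \<in> X \<Longrightarrow>
      \<delta> (k1 (g, free_gen x)) =
        \<sigma> g \<otimes>\<^bsub>F\<^esub> free_gen x \<otimes>\<^bsub>F\<^esub> inv\<^bsub>F\<^esub> (\<sigma> (g \<otimes>\<^bsub>G\<^esub> \<phi> (free_gen x)))"
begin

section \<open>The morphism \<open>k1\<close> and its boundary\<close>

lemma \<sigma>_closed [simp]: "g \<in> carrier G \<Longrightarrow> \<sigma> g \<in> carrier F"
  and \<phi>_\<sigma> [simp]: "g \<in> carrier G \<Longrightarrow> \<phi> (\<sigma> g) = g"
  using \<sigma> by auto

lemma k1_closed [simp]: "g \<in> carrier G \<Longrightarrow> u \<in> carrier F \<Longrightarrow> k1 (g, u) \<in> carrier D"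
  using k1 by (auto simp: groupoid_morphism_def cayley_groupoid_def)

lemma k1_one: "g \<in> carrier G \<Longrightarrow> k1 (g, \<one>\<^bsub>F\<^esub>) = \<one>\<^bsub>D\<^esub>"
  using k1 by (auto simp: groupoid_morphism_def)

lemma k1_mult:
  "g \<in> carrier G \<Longrightarrow> u \<in> carrier F \<Longrightarrow> v \<in> carrier F \<Longrightarrow>
    k1 (g, u \<otimes>\<^bsub>F\<^esub> v) = k1 (g, u) \<otimes>\<^bsub>D\<^esub> k1 (g \<otimes>\<^bsub>G\<^esub> \<phi> u, v)"
  using k1 by (auto simp: groupoid_morphism_def cayley_groupoid_def)

lemma k1_inv:
  assumes "g \<in> carrier G" "u \<in> carrier F"
  shows "k1 (g \<otimes>\<^bsub>G\<^esub> \<phi> u, inv\<^bsub>F\<^esub> u) = inv\<^bsub>D\<^esub> (k1 (g, u))"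
proof -
  have "k1 (g, u) \<otimes>\<^bsub>D\<^esub> k1 (g \<otimes>\<^bsub>G\<^esub> \<phi> u, inv\<^bsub>F\<^esub> u) = \<one>\<^bsub>D\<^esub>"
    using k1_mult[of g u "inv\<^bsub>F\<^esub> u"] assms by (simp add: k1_one)
  then show ?thesis using assms by (intro D.inv_equality[symmetric, OF D.inv_comm]) auto
qed

text \<open>The right-hand side is itself multiplicative along composable arrows, so the generators
  decide. The vertex \<open>g\<close> must vary in the induction, since inverses and second factors
  start elsewhere.\<close>

lemma \<delta>_k1:
  assumes "u \<in> carrier F" "g \<in> carrier G"
  shows "\<delta> (k1 (g, u)) = \<sigma> g \<otimes>\<^bsub>F\<^esub> u \<otimes>\<^bsub>F\<^esub> inv\<^bsub>F\<^esub> (\<sigma> (g \<otimes>\<^bsub>G\<^esub> \<phi> u))"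
  using assms
proof (induction arbitrary: g rule: free_group_induct)
  case one
  then show ?case by (simp add: k1_one)
next
  case (gen x)
  then show ?case by (simp add: k1_gen)
next
  case (inv u)
  \<comment> \<open>The arrow labelled \<open>u\<close> that ends at \<open>g\<close> starts here;
    its inverse is the arrow \<open>(g, inv u)\<close>.\<close>
  let ?g = "g \<otimes>\<^bsub>G\<^esub> inv\<^bsub>G\<^esub> \<phi> u"
  have g: "?g \<in> carrier G" "?g \<otimes>\<^bsub>G\<^esub> \<phi> u = g" using inv by (auto simp: G.m_assoc)
  have "k1 (g, inv\<^bsub>F\<^esub> u) = inv\<^bsub>D\<^esub> (k1 (?g, u))" using k1_inv[OF g(1) inv(1)] g(2) by simp
  then show ?case using inv(1,3) g inv(2)[OF g(1)]
    by (simp add: P.inv_mult_group P.m_assoc)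
next
  case (mult u v)
  \<comment> \<open>Cancels the two representatives of the intermediate vertex.\<close>
  have "inv\<^bsub>F\<^esub> \<sigma> (g \<otimes>\<^bsub>G\<^esub> \<phi> u) \<otimes>\<^bsub>F\<^esub> (\<sigma> (g \<otimes>\<^bsub>G\<^esub> \<phi> u) \<otimes>\<^bsub>F\<^esub> z) = z" if "z \<in> carrier F" for z
    using mult that by (simp flip: P.m_assoc)
  then show ?case using mult by (simp add: k1_mult P.m_assoc G.m_assoc)
qed

section \<open>The deviation of \<open>k1\<close> on boundaries\<close>

text \<open>At \<open>c = \<iota> r\<close> this is the formula for \<delta>3[g, r], extended to all
  of \<open>C\<close>.\<close>

definition deviation :: "'g \<Rightarrow> ('r \<times> 'x word) word set \<Rightarrow> ('r \<times> 'x word) word set" where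
  "deviation g c = inv\<^bsub>D\<^esub> (k1 (g, \<delta> c)) \<otimes>\<^bsub>D\<^esub> Act C c (inv\<^bsub>F\<^esub> (\<sigma> g))"

text \<open>Since \<open>(g, \<delta> c)\<close> is a loop, both \<open>k1 (g, \<delta> c)\<close>
  and the translate of \<open>c\<close> have boundary \<open>\<delta> c\<close> conjugated by
  \<open>\<sigma> g\<close>.\<close>

lemma deviation_\<pi>:
  assumes "g \<in> carrier G" "c \<in> carrier D" shows "deviation g c \<in> carrier \<pi>"
  using assms by (simp add: deviation_def \<pi>_carrier \<delta>_k1 \<phi>_\<delta> \<delta>_Act)

lemma deviation_closed:
  assumes "g \<in> carrier G" "c \<in> carrier D" shows "deviation g c \<in> carrier D"
  using deviation_\<pi>[OF assms] by (simp add: \<pi>_carrier)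

text \<open>Expanding the left side puts \<open>deviation g c\<close> between the two factors of
  \<open>deviation g d\<close>; being central, it moves to the front.\<close>

lemma deviation_mult:
  assumes g: "g \<in> carrier G" and c: "c \<in> carrier D" and d: "d \<in> carrier D"
  shows "deviation g (c \<otimes>\<^bsub>D\<^esub> d) = deviation g c \<otimes>\<^bsub>D\<^esub> deviation g d"
proof -
  let ?s = "inv\<^bsub>F\<^esub> (\<sigma> g)"
  have "deviation g (c \<otimes>\<^bsub>D\<^esub> d) = inv\<^bsub>D\<^esub> (k1 (g, \<delta> d)) \<otimes>\<^bsub>D\<^esub> deviation g c \<otimes>\<^bsub>D\<^esub> Act C d ?s"
    using assms by (simp add: deviation_def k1_mult \<phi>_\<delta> Act_mult D.inv_mult_group D.m_assoc)
  also have "inv\<^bsub>D\<^esub> (k1 (g, \<delta> d)) \<otimes>\<^bsub>D\<^esub> deviation g c = deviation g c \<otimes>\<^bsub>D\<^esub> inv\<^bsub>D\<^esub> (k1 (g, \<delta> d))"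
    using assms by (intro \<pi>_central deviation_\<pi>) auto
  finally show ?thesis
    using assms by (simp add: D.m_assoc deviation_closed) (simp add: deviation_def)
qed

text \<open>Each factor on the left is the matching factor of \<open>deviation g c\<close> acted on
  by the boundary of \<open>k1 (g, u)\<close>. Boundaries map to 1 in \<open>G\<close>, so they fix
  identities.\<close>

lemma deviation_Act:
  assumes g: "g \<in> carrier G" and c: "c \<in> carrier D" and u: "u \<in> carrier F"
  shows "deviation (g \<otimes>\<^bsub>G\<^esub> \<phi> u) (Act C c u) = deviation g c"
proof -
  let ?h = "g \<otimes>\<^bsub>G\<^esub> \<phi> u" and ?a = "k1 (g, u)" and ?b = "k1 (g, \<delta> c)"
  let ?s = "inv\<^bsub>F\<^esub> (\<sigma> g)" and ?t = "inv\<^bsub>F\<^esub> (\<sigma> (g \<otimes>\<^bsub>G\<^esub> \<phi> u))"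
  have h: "?h \<in> carrier G" using g u by simp
  have da: "\<delta> ?a = \<sigma> g \<otimes>\<^bsub>F\<^esub> u \<otimes>\<^bsub>F\<^esub> ?t" using g u by (simp add: \<delta>_k1)
  \<comment> \<open>The loop at \<open>?h\<close> is the loop \<open>(g, \<delta> c)\<close>
    conjugated by the arrow \<open>(g, u)\<close>; the Peiffer rule then turns conjugation by
    \<open>?a\<close> into the action of \<open>\<delta> ?a\<close>.\<close>
  have "k1 (?h, inv\<^bsub>F\<^esub> u \<otimes>\<^bsub>F\<^esub> (\<delta> c \<otimes>\<^bsub>F\<^esub> u)) = inv\<^bsub>D\<^esub> ?a \<otimes>\<^bsub>D\<^esub> (?b \<otimes>\<^bsub>D\<^esub> ?a)"
    using g c u by (simp add: k1_mult[OF h] k1_mult[OF g] k1_inv \<phi>_\<delta> G.m_assoc)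
  then have "k1 (?h, \<delta> (Act C c u)) = Act C ?b (\<delta> ?a)"
    using g c u by (simp add: \<delta>_Act P.m_assoc D.m_assoc flip: Peiffer)
  then have k: "inv\<^bsub>D\<^esub> (k1 (?h, \<delta> (Act C c u))) = Act C (inv\<^bsub>D\<^esub> ?b) (\<delta> ?a)"
    using g c u by (simp add: Act_inv)
  have "?s \<otimes>\<^bsub>F\<^esub> \<delta> ?a = u \<otimes>\<^bsub>F\<^esub> ?t"
    unfolding da using g u by (simp add: P.m_assoc) (simp flip: P.m_assoc)
  then have "Act C (Act C c u) ?t = Act C (Act C c ?s) (\<delta> ?a)"
    using g c u by (simp add: Act_Act)
  then have "deviation ?h (Act C c u) = Act C (deviation g c) (\<delta> ?a)"
    using g c u k by (simp add: deviation_def Act_mult)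
  also have "\<dots> = gact \<pi> (deviation g c) (\<phi> (\<delta> ?a))"
    using g c u by (simp only: \<pi>_gact deviation_\<pi> k1_closed \<delta>.hom_closed)
  also have "\<dots> = deviation g c"
    using g c u by (simp only: \<phi>_\<delta> k1_closed \<pi>.gact_one deviation_\<pi>)
  finally show ?thesis .
qed

text \<open>With trivial boundary the \<open>k1\<close> factor is 1, and the inverse of
  \<open>\<sigma> g\<close> is a preimage of the inverse of \<open>g\<close>.\<close>

lemma deviation_identity:
  assumes "g \<in> carrier G" "c \<in> carrier \<pi>"
  shows "deviation g c = gact \<pi> c (inv\<^bsub>G\<^esub> g)"
  using assms \<pi>_gact[of c "inv\<^bsub>F\<^esub> (\<sigma> g)"] by (simp add: deviation_def \<pi>_carrier k1_one)

text \<open>The deviation is also a family of homomorphisms killing the operation, and such families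
  are determined by the generators. This is applied to \<delta>3 composed with
  \<open>k2\<close>.\<close>

lemma kills_operation_eq_deviation:
  assumes k: "kills_operation (cayley_groupoid G F \<phi>) (cayley_xmod G \<phi> C) \<pi> (\<lambda>_. k)"
    and k_gen: "\<And>g r. g \<in> carrier G \<Longrightarrow> r \<in> R \<Longrightarrow> k (g, \<iota> r) = deviation g (\<iota> r)"
    and g: "g \<in> carrier G" and c: "c \<in> carrier D"
  shows "k (g, c) = deviation g c"
proof (rule C_hom_unique[OF \<pi>.is_group _ _ _ c, of "\<lambda>c. k (g, c)"])
  have "k \<in> hom (Grp (cayley_xmod G \<phi> C) g) \<pi>" using k g by (simp add: kills_operation_def)
  then show "(\<lambda>c. k (g, c)) \<in> hom D \<pi>" by (auto simp: hom_def Pi_iff)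
  show "deviation g \<in> hom D \<pi>"
    using g by (auto intro: homI simp: deviation_\<pi> deviation_mult \<pi>_mult)
  fix r p assume rp: "r \<in> R" "p \<in> carrier F"
  \<comment> \<open>The translate of \<open>\<iota> r\<close> by \<open>p\<close> at vertex
    \<open>g\<close> comes from the generator at this vertex, along the arrow labelled
    \<open>p\<close>.\<close>
  let ?g = "g \<otimes>\<^bsub>G\<^esub> inv\<^bsub>G\<^esub> \<phi> p"
  have g': "?g \<in> carrier G" "?g \<otimes>\<^bsub>G\<^esub> \<phi> p = g" using g rp by (auto simp: G.m_assoc)
  have \<iota>: "\<iota> r \<in> carrier D" using rp by (simp add: \<iota>_closed)
  have "(?g, p) \<in> Homset (cayley_groupoid G F \<phi>) ?g g" "(?g, \<iota> r) \<in> carrier (Grp (cayley_xmod G \<phi> C) ?g)"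
    using g' rp \<iota> by auto
  then have "k (Act (cayley_xmod G \<phi> C) (?g, \<iota> r) (?g, p)) = k (?g, \<iota> r)"
    using k unfolding kills_operation_def by blast
  then have "k (g, Act C (\<iota> r) p) = deviation ?g (\<iota> r)"
    using g' rp by (simp add: k_gen)
  then show "k (g, Act C (\<iota> r) p) = deviation g (Act C (\<iota> r) p)"
    using deviation_Act[OF g'(1) \<iota> rp(2)] g'(2) by simp
qed

end

section \<open>The two inclusions between the span and the kernel\<close>

theorem (in cayley_contraction) span_relations:
  fixes \<delta>3 :: "(('g \<times> 'r) \<times> 'g \<Rightarrow>\<^sub>0 int) \<Rightarrow> ('r \<times> 'x word) word set"
    and k2 :: "'g \<times> ('r \<times> 'x word) word set \<Rightarrow> (('g \<times> 'r) \<times> 'g \<Rightarrow>\<^sub>0 int)"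
  assumes J: "J \<subseteq> carrier G \<times> R"
    and \<delta>3: "\<delta>3 \<in> gmodule_hom G (free_gmodule G (carrier G \<times> R)) \<pi>"
    and \<delta>3_gen: "\<And>g r. g \<in> carrier G \<Longrightarrow> r \<in> R \<Longrightarrow> \<delta>3 (free_gmodule_gen G (g, r)) = deviation g (\<iota> r)"
    and k2: "kills_operation (cayley_groupoid G F \<phi>) (cayley_xmod G \<phi> C) (free_gmodule G J) (\<lambda>_. k2)"
    and k2_gen: "\<And>g r. g \<in> carrier G \<Longrightarrow> r \<in> R \<Longrightarrow>
      \<delta>3 (k2 (g, \<iota> r)) = \<delta>3 (free_gmodule_gen G (g, r))"
  defines "\<delta>4 \<equiv> \<lambda>g \<gamma>. - k2 (g, \<delta>3 (free_gmodule_gen G \<gamma>))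
    + gact (free_gmodule G J) (free_gmodule_gen G \<gamma>) (inv\<^bsub>G\<^esub> g)"
  shows "gmodule_span G (free_gmodule G J) {\<delta>4 g \<gamma> | g \<gamma>. g \<in> carrier G \<and> \<gamma> \<in> J}
    = kernel (free_gmodule G J) \<pi> \<delta>3"
proof -
  let ?M = "free_gmodule G J" and ?gen = "free_gmodule_gen G :: 'g \<times> 'r \<Rightarrow> _"
  define S where "S = {\<delta>4 g \<gamma> | g \<gamma>. g \<in> carrier G \<and> \<gamma> \<in> J}"
  interpret M: right_gmodule G ?M by (rule right_gmodule_free_gmodule[OF G.is_group])
  have inv_M: "inv\<^bsub>?M\<^esub> x = - x" if "x \<in> carrier ?M" for x
    by (rule inv_free_gmodule[OF G.is_group that])
  have gen: "?gen \<gamma> \<in> carrier ?M" if "\<gamma> \<in> J" for \<gamma>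
    using that by (simp add: free_gmodule_gen_def)
  have \<delta>3_J: "\<delta>3 \<in> gmodule_hom G ?M \<pi>"
    using \<delta>3 gmodule_hom_free_mono[OF J] by blast
  interpret \<delta>3: group_hom ?M \<pi> \<delta>3
    by unfold_locales (use \<delta>3_J in \<open>simp add: gmodule_hom_def\<close>)
  have \<delta>3_gact: "\<delta>3 (gact ?M x g) = gact \<pi> (\<delta>3 x) g" if "x \<in> carrier ?M" "g \<in> carrier G" for x g
    using \<delta>3_J that by (simp add: gmodule_hom_def)
  have k2_hom: "(\<lambda>c. k2 (g, c)) \<in> hom D ?M" if "g \<in> carrier G" for g
  proof -
    have "k2 \<in> hom (Grp (cayley_xmod G \<phi> C) g) ?M" using k2 that by (simp add: kills_operation_def)
    then show ?thesis by (auto simp: hom_def Pi_iff simp del: free_gmodule_simps(1))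
  qed
  have k2_closed: "k2 (g, c) \<in> carrier ?M" if "g \<in> carrier G" "c \<in> carrier D" for g c
    using k2_hom that by (auto simp: hom_def simp del: free_gmodule_simps(1))
  have k2_Act: "k2 (g \<otimes>\<^bsub>G\<^esub> \<phi> u, Act C c u) = k2 (g, c)"
    if "g \<in> carrier G" "c \<in> carrier D" "u \<in> carrier F" for g c u
  proof -
    have "(g, u) \<in> Homset (cayley_groupoid G F \<phi>) g (g \<otimes>\<^bsub>G\<^esub> \<phi> u)"
      "(g, c) \<in> carrier (Grp (cayley_xmod G \<phi> C) g)"
      using that by auto
    then have "k2 (Act (cayley_xmod G \<phi> C) (g, c) (g, u)) = k2 (g, c)"
      using k2 unfolding kills_operation_def by blast
    then show ?thesis by simp
  qed
  \<comment> \<open>Composing \<open>k2\<close> with \<delta>3 still kills the operation, so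
    agreement with the deviation on generators suffices.\<close>
  have \<delta>3_k2: "\<delta>3 (k2 (g, c)) = deviation g c" if "g \<in> carrier G" "c \<in> carrier D" for g c
  proof (rule kills_operation_eq_deviation[OF _ _ that, of "\<lambda>m. \<delta>3 (k2 m)"])
    show "kills_operation (cayley_groupoid G F \<phi>) (cayley_xmod G \<phi> C) \<pi> (\<lambda>_ m. \<delta>3 (k2 m))"
      using k2 hom_compose[OF _ \<delta>3.homh, of k2, unfolded comp_def]
      unfolding kills_operation_def by metis
  qed (simp add: k2_gen \<delta>3_gen)
  have \<delta>3_D: "\<delta>3 x \<in> carrier D" if "x \<in> carrier ?M" for x
    using \<delta>3.hom_closed[OF that] by (simp add: \<pi>_carrier)
  have S_M: "S \<subseteq> carrier ?M"
  proof
    fix x assume "x \<in> S"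
    then obtain g \<gamma> where x: "x = \<delta>4 g \<gamma>" and g: "g \<in> carrier G" and \<gamma>: "\<gamma> \<in> J" by (auto simp: S_def)
    have "inv\<^bsub>?M\<^esub> (k2 (g, \<delta>3 (?gen \<gamma>))) \<otimes>\<^bsub>?M\<^esub> gact ?M (?gen \<gamma>) (inv\<^bsub>G\<^esub> g) \<in> carrier ?M"
      using g gen[OF \<gamma>] by (intro M.m_closed M.inv_closed k2_closed M.gact_closed \<delta>3_D G.inv_closed)
    then show "x \<in> carrier ?M"
      unfolding x \<delta>4_def using inv_M[OF k2_closed[OF g \<delta>3_D[OF gen[OF \<gamma>]]]] by simp
  qed
  have "S \<subseteq> kernel ?M \<pi> \<delta>3"
  proof
    fix x assume xS: "x \<in> S"
    then obtain g \<gamma> where x: "x = \<delta>4 g \<gamma>" and g: "g \<in> carrier G" and \<gamma>: "\<gamma> \<in> J" by (auto simp: S_def)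
    let ?k = "k2 (g, \<delta>3 (?gen \<gamma>))" and ?y = "gact ?M (?gen \<gamma>) (inv\<^bsub>G\<^esub> g)"
    have k: "?k \<in> carrier ?M" by (rule k2_closed[OF g \<delta>3_D[OF gen[OF \<gamma>]]])
    have y: "?y \<in> carrier ?M" using g gen[OF \<gamma>] by (intro M.gact_closed G.inv_closed)
    \<comment> \<open>As \<open>\<delta>3 (?gen \<gamma>)\<close> is an identity, its translate by
      the inverse of \<open>g\<close> is its deviation, which is also the image of
      \<open>?k\<close>.\<close>
    have "\<delta>3 ?y = deviation g (\<delta>3 (?gen \<gamma>))"
      using g gen[OF \<gamma>] \<delta>3.hom_closed[OF gen[OF \<gamma>]] by (simp only: \<delta>3_gact G.inv_closed deviation_identity)
    then have eq: "\<delta>3 ?y = \<delta>3 ?k" using g \<delta>3_D[OF gen[OF \<gamma>]] by (simp only: \<delta>3_k2)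
    have "x = inv\<^bsub>?M\<^esub> ?k \<otimes>\<^bsub>?M\<^esub> ?y" by (simp add: x \<delta>4_def inv_M[OF k])
    then have "\<delta>3 x = inv\<^bsub>\<pi>\<^esub> \<delta>3 ?k \<otimes>\<^bsub>\<pi>\<^esub> \<delta>3 ?y"
      using k y by (simp only: \<delta>3.hom_mult \<delta>3.hom_inv M.inv_closed)
    then have "\<delta>3 x = \<one>\<^bsub>\<pi>\<^esub>" unfolding eq using \<delta>3.hom_closed[OF k] by simp
    then show "x \<in> kernel ?M \<pi> \<delta>3" using subsetD[OF S_M xS] by (simp add: kernel_def)
  qed
  then have "gmodule_span G ?M S \<subseteq> kernel ?M \<pi> \<delta>3"
    by (rule span_minimal[OF submodule_kernel[OF M.right_gmodule_axioms \<pi>.right_gmodule_axioms \<delta>3_J]])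
  moreover have "kernel ?M \<pi> \<delta>3 \<subseteq> gmodule_span G ?M S"
  proof
    fix x assume x: "x \<in> kernel ?M \<pi> \<delta>3"
    interpret K: subgroup "gmodule_span G ?M S" ?M
      using submodule_span[OF M.right_gmodule_axioms S_M] by (simp add: submodule_def)
    have span_diff: "a - b \<in> gmodule_span G ?M S" if "a \<in> gmodule_span G ?M S" "b \<in> gmodule_span G ?M S" for a b
      using K.m_closed[OF that(1) K.m_inv_closed[OF that(2)]] K.mem_carrier[OF that(2)] inv_M by simp
    interpret k: group_hom D ?M "\<lambda>c. k2 (\<one>\<^bsub>G\<^esub>, c)"
      by unfold_locales (rule k2_hom[OF G.one_closed])
    \<comment> \<open>Viewing \<delta>3 as a map into all of \<open>D\<close> lets it be composed
      with \<open>k2\<close> at the vertex 1.\<close>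
    interpret \<delta>3_D: group_hom ?M D \<delta>3
      using \<delta>3.homh \<delta>3_D by unfold_locales (auto intro!: homI simp: \<pi>_mult dest: \<delta>3.hom_mult)
    have k_diff: "k2 (\<one>\<^bsub>G\<^esub>, \<delta>3 (a - b)) = k2 (\<one>\<^bsub>G\<^esub>, \<delta>3 a) - k2 (\<one>\<^bsub>G\<^esub>, \<delta>3 b)"
      if a: "a \<in> carrier ?M" and b: "b \<in> carrier ?M" for a b
    proof -
      have "a - b = a \<otimes>\<^bsub>?M\<^esub> inv\<^bsub>?M\<^esub> b" using inv_M[OF b] by simp
      then have "k2 (\<one>\<^bsub>G\<^esub>, \<delta>3 (a - b)) = k2 (\<one>\<^bsub>G\<^esub>, \<delta>3 a) \<otimes>\<^bsub>?M\<^esub> inv\<^bsub>?M\<^esub> k2 (\<one>\<^bsub>G\<^esub>, \<delta>3 b)"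
        using a b by (simp only: \<delta>3_D.hom_mult \<delta>3_D.hom_inv k.hom_mult k.hom_inv M.inv_closed
            D.inv_closed \<delta>3_D.hom_closed)
      then show ?thesis using inv_M[OF k2_closed[OF G.one_closed \<delta>3_D[OF b]]] by simp
    qed
    have "Poly_Mapping.keys x \<subseteq> J \<times> carrier G" using x by (simp add: kernel_def)
    \<comment> \<open>The expression is additive in \<open>x\<close>, and a basis element \<gamma>g
      yields a member of \<open>S\<close> itself; closure of the span under differences does the
      rest.\<close>
    then have "x - k2 (\<one>\<^bsub>G\<^esub>, \<delta>3 x) \<in> gmodule_span G ?M S"
    proof (rule free_Abelian_group_induct[where P = "\<lambda>x. x - k2 (\<one>\<^bsub>G\<^esub>, \<delta>3 x) \<in> gmodule_span G ?M S"])
      show "0 - k2 (\<one>\<^bsub>G\<^esub>, \<delta>3 0) \<in> gmodule_span G ?M S" using K.one_closed \<delta>3_D.hom_one k.hom_one by simp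
    next
      fix a b
      assume ab: "Poly_Mapping.keys a \<subseteq> J \<times> carrier G" "Poly_Mapping.keys b \<subseteq> J \<times> carrier G"
        and IH: "a - k2 (\<one>\<^bsub>G\<^esub>, \<delta>3 a) \<in> gmodule_span G ?M S" "b - k2 (\<one>\<^bsub>G\<^esub>, \<delta>3 b) \<in> gmodule_span G ?M S"
      have "a - b - k2 (\<one>\<^bsub>G\<^esub>, \<delta>3 (a - b)) = a - k2 (\<one>\<^bsub>G\<^esub>, \<delta>3 a) - (b - k2 (\<one>\<^bsub>G\<^esub>, \<delta>3 b))"
        using ab by (simp add: k_diff)
      then show "a - b - k2 (\<one>\<^bsub>G\<^esub>, \<delta>3 (a - b)) \<in> gmodule_span G ?M S"
        by (simp only: span_diff[OF IH])
    next
      fix z assume "z \<in> J \<times> carrier G"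
      then obtain \<gamma> g where z: "z = (\<gamma>, g)" "\<gamma> \<in> J" "g \<in> carrier G" by auto
      obtain u where u: "u \<in> carrier F" "\<phi> u = g" using \<phi>_surj[OF z(3)] by blast
      have c: "\<delta>3 (?gen \<gamma>) \<in> carrier \<pi>" by (rule \<delta>3.hom_closed[OF gen[OF z(2)]])
      have f: "frag_of z = gact ?M (?gen \<gamma>) g" using z by (simp add: free_gmodule_gen_def)
      have "\<delta>3 (frag_of z) = Act C (\<delta>3 (?gen \<gamma>)) u"
        unfolding f \<delta>3_gact[OF gen[OF z(2)] z(3)] using \<pi>_gact[OF c u(1)] u(2) by simp
      \<comment> \<open>The arrow labelled \<open>u\<close> from the inverse of \<open>g\<close>
        ends at 1, and \<open>k2\<close> is constant along it.\<close>
      then have "k2 (\<one>\<^bsub>G\<^esub>, \<delta>3 (frag_of z)) = k2 (inv\<^bsub>G\<^esub> g, \<delta>3 (?gen \<gamma>))"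
        using k2_Act[of "inv\<^bsub>G\<^esub> g" "\<delta>3 (?gen \<gamma>)" u] z u c by (simp add: \<pi>_carrier)
      then have "frag_of z - k2 (\<one>\<^bsub>G\<^esub>, \<delta>3 (frag_of z)) = \<delta>4 (inv\<^bsub>G\<^esub> g) \<gamma>"
        using z f by (simp add: \<delta>4_def)
      then have "frag_of z - k2 (\<one>\<^bsub>G\<^esub>, \<delta>3 (frag_of z)) \<in> S"
        unfolding S_def using z(2) G.inv_closed[OF z(3)] by blast
      then show "frag_of z - k2 (\<one>\<^bsub>G\<^esub>, \<delta>3 (frag_of z)) \<in> gmodule_span G ?M S"
        by (rule subsetD[OF span_superset])
    qed
    moreover have "k2 (\<one>\<^bsub>G\<^esub>, \<delta>3 x) = 0" using x k.hom_one by (simp add: kernel_def \<pi>_one)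
    ultimately show "x \<in> gmodule_span G ?M S" by simp
  qed
  ultimately show ?thesis by (simp add: S_def)
qed

text \<open>The basis element [g, r] is encoded as the pair \<open>(g, r)\<close>. One function
  \<open>k2\<close> serves all vertices because the elements at \<open>g\<close> carry
  \<open>g\<close> as first component; the chosen expressions are its values on generators.\<close>

theorem theoremB:
  fixes G :: "('g, 'k) monoid_scheme"
    and X :: "'x set" and R :: "'r set"
    and \<omega> :: "'r \<Rightarrow> 'x word" and \<phi> :: "'x word \<Rightarrow> 'g" and \<sigma> :: "'g \<Rightarrow> 'x word"
    and k1 :: "'g \<times> 'x word \<Rightarrow> ('r \<times> 'x word) word set"
    and \<delta>3 :: "(('g \<times> 'r) \<times> 'g \<Rightarrow>\<^sub>0 int) \<Rightarrow> ('r \<times> 'x word) word set"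
    and k2 :: "'g \<times> ('r \<times> 'x word) word set \<Rightarrow> (('g \<times> 'r) \<times> 'g \<Rightarrow>\<^sub>0 int)"
    and J :: "('g \<times> 'r) set"
  assumes pres: "presentation G X R \<omega> \<phi>"
    and F: "F = free_group X"
    and C: "C = free_xmod F R \<omega>"
    and \<pi>: "\<pi> = identity_module F \<phi> C"
    and \<sigma>: "\<And>g. g \<in> carrier G \<Longrightarrow> \<sigma> g \<in> carrier F \<and> \<phi> (\<sigma> g) = g"
    and k1: "groupoid_morphism (cayley_groupoid G F \<phi>) (one_object (Grp C ())) (\<lambda>_. ()) k1"
    and k1_gen: "\<And>g x. g \<in> carrier G \<Longrightarrow> x \<in> X \<Longrightarrow>
      Bd C () (k1 (g, free_gen x)) =
        \<sigma> g \<otimes>\<^bsub>F\<^esub> free_gen x \<otimes>\<^bsub>F\<^esub> inv\<^bsub>F\<^esub> (\<sigma> (g \<otimes>\<^bsub>G\<^esub> \<phi> (free_gen x)))"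
    and I: "I = carrier G \<times> R"
    and \<delta>3: "\<delta>3 \<in> gmodule_hom G (free_gmodule G I) \<pi>"
    and \<delta>3_gen: "\<And>g r. g \<in> carrier G \<Longrightarrow> r \<in> R \<Longrightarrow>
      \<delta>3 (free_gmodule_gen G (g, r)) =
        inv\<^bsub>Grp C ()\<^esub> (k1 (g, \<omega> r)) \<otimes>\<^bsub>Grp C ()\<^esub> Act C (free_xmod_gen F R \<omega> r) (inv\<^bsub>F\<^esub> (\<sigma> g))"
    and J: "J \<subseteq> I"
    and J_generates: "gmodule_span G \<pi> (\<delta>3 ` free_gmodule_gen G ` J) = carrier \<pi>"
    and J_minimal: "\<And>J'. J' \<subset> J \<Longrightarrow>
      gmodule_span G \<pi> (\<delta>3 ` free_gmodule_gen G ` J') \<noteq> carrier \<pi>"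
    and k2: "kills_operation (cayley_groupoid G F \<phi>) (cayley_xmod G \<phi> C) (free_gmodule G J) (\<lambda>_. k2)"
    and k2_gen: "\<And>g r. g \<in> carrier G \<Longrightarrow> r \<in> R \<Longrightarrow>
      \<delta>3 (k2 (g, free_xmod_gen F R \<omega> r)) = \<delta>3 (free_gmodule_gen G (g, r))"
  shows "gmodule_span G (free_gmodule G J)
      {- k2 (g, \<delta>3 (free_gmodule_gen G \<gamma>))
         + gact (free_gmodule G J) (free_gmodule_gen G \<gamma>) (inv\<^bsub>G\<^esub> g) | g \<gamma>. g \<in> carrier G \<and> \<gamma> \<in> J}
    = kernel (free_gmodule G J) \<pi> \<delta>3"
proof -
  interpret cayley_contraction G X R \<omega> \<phi> \<sigma> k1
    by (rule cayley_contraction.intro[OF group_presentation.intro[OF pres]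
          cayley_contraction_axioms.intro[OF \<sigma>[unfolded F] k1[unfolded C F] k1_gen[unfolded C F]]])
  \<comment> \<open>The boundary of the generator at \<open>r\<close> is \<open>\<omega> r\<close>,
    so the prescribed formula is the deviation there.\<close>
  have gen: "\<delta>3 (free_gmodule_gen G (g, r)) = deviation g (free_xmod_gen (free_group X) R \<omega> r)"
    if "g \<in> carrier G" "r \<in> R" for g r
    using \<delta>3_gen[OF that] \<iota>_Bd[OF that(2), of "()"] by (simp only: deviation_def C F)
  show ?thesis
    unfolding \<pi> C F
    by (rule span_relations[OF J[unfolded I] \<delta>3[unfolded I \<pi> C F] gen k2[unfolded C F]
          k2_gen[unfolded C F]])
qed

end
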